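(* It holds that $\lambda_{4,3}=1/2$. The lower bound comes from blowups of the pattern $B=(2,\{00,11\})$ (two isolated loops) and also from blowups of the pattern $B=(2,\{01\})$ (a single edge): for each of these two patterns, the maximum of $\lambda_{4,3}(B(\mathbf{a}))$ over $\mathbf{a}\in\mathbb{S}_2$ equals $1/2$, and $\mathbf{a}=(1/2,1/2)$ is the unique maximizer. The upper bound $\lambda_{4,3}\le 1/2$ has a flag algebra certificate on $N=6$ vertices.
   Context: Graphs are finite and simple. $[m]:=\{0,\dots,m-1\}$, $ij$ abbreviates the unordered pair $\{i,j\}$ (with $ii$ a loop at $i$), and $(m,E)$ denotes the graph/pattern with vertex set $[m]$ and edge set $E$. Edge-inducibility: for non-negative integers $\kappa,\ell$ and a graph $G$ with $n\ge\kappa$ vertices, $\lambda_{\kappa,\ell}(G)$ is the number of $\kappa$-subsets of $V(G)$ that span exactly $\ell$ edges of $G$, divided by $\binom{n}{\kappa}$. Further, $\lambda_{\kappa,\ell}(n):=\max\{\lambda_{\kappa,\ell}(G): G \text{ is an } n\text{-vertex graph}\}$ and $\lambda_{\kappa,\ell}:=\lim_{n\to\infty}\lambda_{\kappa,\ell}(n)$ (the limit exists). A pattern $B$ is a graph in which loops on some vertices are additionally allowed (no multiple edges). For a pattern $B$ with vertex set $[m]$ and pairwise disjoint finite sets $V_0,\dots,V_{m-1}$ (some possibly empty), the blowup $B(V_0,\dots,V_{m-1})$ is the (loopless) graph on $V_0\cup\dots\cup V_{m-1}$ in which distinct $x\in V_i$, $y\in V_j$ are adjacent iff $\{i,j\}\in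 E(B)$ (so $V_i$ is a clique if $i$ has a loop, and an independent set otherwise). $\mathbb{S}_m:=\{(x_0,\dots,x_{m-1})\in\mathbb{R}^m: \sum_i x_i=1,\ x_i\ge 0 \text{ for all } i\}$. For $\mathbf{x}\in\mathbb{S}_m$, $\lambda_{\kappa,\ell}(B(\mathbf{x}))$ is the limit as $n\to\infty$ of $\lambda_{\kappa,\ell}(B(V_0,\dots,V_{m-1}))$ where $|V_i|=(x_i+o(1))n$ for each $i\in[m]$. A maximizer is an $\mathbf{x}\in\mathbb{S}_m$ at which this function attains its maximum over $\mathbb{S}_m$. Flag algebra certificates. $\mathcal{F}^0_N$ is the set of $N$-vertex graphs up to isomorphism (one representative each), and $P(F,G)$ is the number of $v(F)$-subsets of $V(G)$ inducing a copy of $F$. A type $\tau$ is a graph with vertex set $[q]$. A $\tau$-flag is a pair $(F,f)$ with $F$ a graph and $f:[q]\to V(F)$ an embedding of $\tau$ (injective, preserving edges and non-edges); isomorphisms of $\tau$-flags must preserve each labelled root. $\mathcal{F}^\tau_s$ is the set of $s$-vertex $\tau$-flags up to isomorphism, in a fixed order. For $\tau$-flags, $P((F,f),(H,h))$ is the number of $(v(F)-q)$-subsets $X\subseteq V(H)\setminus h([q])$ such that $(H[X\cup h([q])],h)$ is isomorphic to $(F,f)$, and $\mathbf{V}^{\tau,s}_{(H,h)}:=\big(P((F,f),(H,h))\big)_{(F,f)\in\mathcal{F}^\tau_s}$. A flag algebra certificate on $N\ge\kappa$ vertices for the bound $\lambda_{\kappa,\ell}\le u$ consists of a positive semi-definite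 matrix $X^\tau$, indexed by $\mathcal{F}^\tau_s$ with $s=(N+q)/2$, for each type $\tau$ on $[q]$ with $1\le q\le N-2$ and $q\equiv N\pmod 2$ (where from each class of types isomorphic as unlabelled graphs only one representative is listed and the zero matrix is used for all others), and of real numbers $c_F\ge0$ for $F\in\mathcal{F}^0_N$, such that for every graph $G$ of order $n\to\infty$ $$\sum_{F\in\mathcal{F}^0_N}(u-\lambda_{\kappa,\ell}(F))P(F,G)=\sum_{\substack{1\le q\le N-2\\ q\equiv N \bmod 2}}\ \sum_{f:[q]\hookrightarrow V(G)}\big(\mathbf{V}^{\tau,s}_{(G,f)}\big)^{T}X^\tau\,\mathbf{V}^{\tau,s}_{(G,f)}+\sum_{F\in\mathcal{F}^0_N}c_F P(F,G)+O(n^{N-1}),$$ where the inner sum is over injections $f$, $s=(N+q)/2$, and $\tau$ is the graph on $[q]$ for which $f$ is an embedding of $\tau$ into $G$. *)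

theory Defs
  imports Complex_Main "HOL-Library.FuncSet"
begin

section \<open>Graphs\<close>

text \<open>A graph is a pair of a vertex set and a set of edges, each edge being a two-element set of
  vertices.\<close>

type_synonym 'a graph = "'a set \<times> 'a set set"

abbreviation verts :: "'a graph \<Rightarrow> 'a set" where "verts \<equiv> fst"
abbreviation edges :: "'a graph \<Rightarrow> 'a set set" where "edges \<equiv> snd"

definition is_graph :: "'a graph \<Rightarrow> bool" where
  "is_graph G \<longleftrightarrow> finite (verts G) \<and> (\<forall>e\<in>edges G. e \<subseteq> verts G \<and> card e = 2)"

definition induced :: "'a graph \<Rightarrow> 'a set \<Rightarrow> 'a graph" where
  "induced G S = (S, {e \<in> edges G. e \<subseteq> S})"

definition is_iso :: "('a \<Rightarrow> 'b) \<Rightarrow> 'a graph \<Rightarrow> 'b graph \<Rightarrow> bool" where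
  "is_iso \<phi> G H \<longleftrightarrow> bij_betw \<phi> (verts G) (verts H) \<and>
     (\<forall>x\<in>verts G. \<forall>y\<in>verts G. {x, y} \<in> edges G \<longleftrightarrow> {\<phi> x, \<phi> y} \<in> edges H)"

definition isomorphic :: "'a graph \<Rightarrow> 'b graph \<Rightarrow> bool" where
  "isomorphic G H \<longleftrightarrow> (\<exists>\<phi>. is_iso \<phi> G H)"

section \<open>Edge-inducibility\<close>

definition edge_density :: "nat \<Rightarrow> nat \<Rightarrow> 'a graph \<Rightarrow> real" where
  "edge_density \<kappa> l G =
     real (card {S. S \<subseteq> verts G \<and> card S = \<kappa> \<and> card (edges (induced G S)) = l})
       / real (card (verts G) choose \<kappa>)"

text \<open>Graphs on sets of natural numbers represent all finite graphs up to isomorphism.\<close>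

definition max_edge_density :: "nat \<Rightarrow> nat \<Rightarrow> nat \<Rightarrow> real" where
  "max_edge_density \<kappa> l n =
     Max {edge_density \<kappa> l G | G :: nat graph. is_graph G \<and> card (verts G) = n}"

definition edge_inducibility :: "nat \<Rightarrow> nat \<Rightarrow> real" where
  "edge_inducibility \<kappa> l = lim (max_edge_density \<kappa> l)"

section \<open>Patterns and blowups\<close>

text \<open>The pattern \<open>(m, E)\<close> has vertices \<open>0, \<dots>, m - 1\<close>; the edge \<open>ij\<close> is the set \<open>{i, j}\<close>, so that
  a loop at \<open>i\<close> is the singleton \<open>{i}\<close>.\<close>

type_synonym pattern = "nat \<times> nat set set"

definition blowup :: "pattern \<Rightarrow> (nat \<Rightarrow> 'a set) \<Rightarrow> 'a graph" where
  "blowup B V =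
     (\<Union>i<fst B. V i,
      {{x, y} | x y i j. i < fst B \<and> j < fst B \<and> x \<in> V i \<and> y \<in> V j \<and> x \<noteq> y \<and> {i, j} \<in> snd B})"

text \<open>Vectors in \<open>\<real>\<^sup>m\<close> are lists of length \<open>m\<close>.\<close>

definition prob_simplex :: "nat \<Rightarrow> real list set" where
  "prob_simplex m = {x. length x = m \<and> (\<Sum>i<m. x ! i) = 1 \<and> (\<forall>i<m. 0 \<le> x ! i)}"

text \<open>\<open>V n i\<close> is the \<open>i\<close>-th part at stage \<open>n\<close>; the condition on its size reads
  \<open>|V n i| = (x ! i + o(1)) n\<close>.\<close>

definition blowup_parts :: "nat \<Rightarrow> real list \<Rightarrow> (nat \<Rightarrow> nat \<Rightarrow> nat set) \<Rightarrow> bool" where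
  "blowup_parts m x V \<longleftrightarrow>
     (\<forall>n. \<forall>i<m. finite (V n i)) \<and>
     (\<forall>n. \<forall>i<m. \<forall>j<m. i \<noteq> j \<longrightarrow> V n i \<inter> V n j = {}) \<and>
     (\<forall>i<m. (\<lambda>n. real (card (V n i)) / real n) \<longlonglongrightarrow> x ! i)"

definition has_blowup_density :: "nat \<Rightarrow> nat \<Rightarrow> pattern \<Rightarrow> real list \<Rightarrow> real \<Rightarrow> bool" where
  "has_blowup_density \<kappa> l B x L \<longleftrightarrow>
     (\<forall>V. blowup_parts (fst B) x V \<longrightarrow> (\<lambda>n. edge_density \<kappa> l (blowup B (V n))) \<longlonglongrightarrow> L)"

definition blowup_density :: "nat \<Rightarrow> nat \<Rightarrow> pattern \<Rightarrow> real list \<Rightarrow> real" where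
  "blowup_density \<kappa> l B x = (THE L. has_blowup_density \<kappa> l B x L)"

definition maximizer :: "nat \<Rightarrow> nat \<Rightarrow> pattern \<Rightarrow> real list \<Rightarrow> bool" where
  "maximizer \<kappa> l B x \<longleftrightarrow> x \<in> prob_simplex (fst B) \<and>
     (\<forall>y\<in>prob_simplex (fst B). blowup_density \<kappa> l B y \<le> blowup_density \<kappa> l B x)"

section \<open>Flags\<close>

text \<open>One element of \<open>A\<close> from each class of the equivalence relation \<open>R\<close> on \<open>A\<close>.\<close>

definition representatives :: "('a \<Rightarrow> 'a \<Rightarrow> bool) \<Rightarrow> 'a set \<Rightarrow> 'a set" where
  "representatives R A = (\<lambda>x. SOME y. y \<in> A \<and> R x y) ` A"

definition graphs_on :: "nat \<Rightarrow> nat graph set" where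
  "graphs_on n = {G. is_graph G \<and> verts G = {..<n}}"

definition unlabelled_graphs :: "nat \<Rightarrow> nat graph set" where
  "unlabelled_graphs N = representatives isomorphic (graphs_on N)"

definition graph_count :: "'a graph \<Rightarrow> 'b graph \<Rightarrow> nat" where
  "graph_count F G =
     card {S. S \<subseteq> verts G \<and> card S = card (verts F) \<and> isomorphic (induced G S) F}"

text \<open>A type is an element \<open>\<tau>\<close> of \<open>graphs_on q\<close>. In a \<open>\<tau>\<close>-flag \<open>(F, f)\<close> the root map \<open>f\<close> is
  extensional, that is, \<open>undefined\<close> outside \<open>{..<q}\<close>.\<close>

type_synonym 'a flag = "'a graph \<times> (nat \<Rightarrow> 'a)"

definition embedding :: "nat graph \<Rightarrow> 'a graph \<Rightarrow> (nat \<Rightarrow> 'a) \<Rightarrow> bool" where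
  "embedding \<tau> F f \<longleftrightarrow>
     f \<in> verts \<tau> \<rightarrow>\<^sub>E verts F \<and> inj_on f (verts \<tau>) \<and>
     (\<forall>i\<in>verts \<tau>. \<forall>j\<in>verts \<tau>. {i, j} \<in> edges \<tau> \<longleftrightarrow> {f i, f j} \<in> edges F)"

definition flag_isomorphic :: "nat \<Rightarrow> 'a flag \<Rightarrow> 'b flag \<Rightarrow> bool" where
  "flag_isomorphic q F H \<longleftrightarrow>
     (\<exists>\<phi>. is_iso \<phi> (fst F) (fst H) \<and> (\<forall>i<q. \<phi> (snd F i) = snd H i))"

definition unlabelled_flags :: "nat graph \<Rightarrow> nat \<Rightarrow> nat flag set" where
  "unlabelled_flags \<tau> s =
     representatives (flag_isomorphic (card (verts \<tau>)))
       {(F, f). F \<in> graphs_on s \<and> embedding \<tau> F f}"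

definition flag_count :: "nat \<Rightarrow> 'a flag \<Rightarrow> 'b flag \<Rightarrow> nat" where
  "flag_count q F H =
     card {X. X \<subseteq> verts (fst H) - snd H ` {..<q} \<and> card X = card (verts (fst F)) - q \<and>
              flag_isomorphic q (induced (fst H) (X \<union> snd H ` {..<q}), snd H) F}"

text \<open>The unique type on \<open>{..<q}\<close> that an injection \<open>f\<close> embeds into \<open>G\<close>.\<close>

definition root_type :: "nat \<Rightarrow> 'a graph \<Rightarrow> (nat \<Rightarrow> 'a) \<Rightarrow> nat graph" where
  "root_type q G f = ({..<q}, {{i, j} | i j. i < q \<and> j < q \<and> {f i, f j} \<in> edges G})"

section \<open>Flag algebra certificates\<close>

definition psd_on :: "'i set \<Rightarrow> ('i \<Rightarrow> 'i \<Rightarrow> real) \<Rightarrow> bool" where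
  "psd_on I M \<longleftrightarrow> (\<forall>i\<in>I. \<forall>j\<in>I. M i j = M j i) \<and>
     (\<forall>v. 0 \<le> (\<Sum>i\<in>I. \<Sum>j\<in>I. v i * M i j * v j))"

definition type_sizes :: "nat \<Rightarrow> nat set" where
  "type_sizes N = {q. 1 \<le> q \<and> q + 2 \<le> N \<and> q mod 2 = N mod 2}"

definition types :: "nat \<Rightarrow> nat graph set" where
  "types N = (\<Union>q\<in>type_sizes N. graphs_on q)"

definition flag_index :: "nat \<Rightarrow> nat graph \<Rightarrow> nat flag set" where
  "flag_index N \<tau> = unlabelled_flags \<tau> ((N + card (verts \<tau>)) div 2)"

definition flag_quadratic_form ::
  "nat \<Rightarrow> nat graph \<Rightarrow> (nat flag \<Rightarrow> nat flag \<Rightarrow> real) \<Rightarrow> 'a flag \<Rightarrow> real" where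
  "flag_quadratic_form N \<tau> M H =
     (\<Sum>F\<in>flag_index N \<tau>. \<Sum>F'\<in>flag_index N \<tau>.
        real (flag_count (card (verts \<tau>)) F H) * M F F' * real (flag_count (card (verts \<tau>)) F' H))"

text \<open>The certificate consists of the listed types \<open>T\<close>, one from each isomorphism class, the matrices
  \<open>X\<close> and the coefficients \<open>c\<close>. The constant in the error term \<open>O(n\<^sup>N\<^sup>-\<^sup>1)\<close> is uniform over all
  graphs of order \<open>n\<close>.\<close>

definition flag_certificate ::
  "nat \<Rightarrow> nat \<Rightarrow> real \<Rightarrow> nat \<Rightarrow> nat graph set \<Rightarrow>
   (nat graph \<Rightarrow> nat flag \<Rightarrow> nat flag \<Rightarrow> real) \<Rightarrow> (nat graph \<Rightarrow> real) \<Rightarrow> bool" where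
  "flag_certificate \<kappa> l u N T X c \<longleftrightarrow>
     \<kappa> \<le> N \<and>
     T \<subseteq> types N \<and> (\<forall>\<tau>\<in>types N. \<exists>!\<sigma>. \<sigma> \<in> T \<and> isomorphic \<tau> \<sigma>) \<and>
     (\<forall>\<tau>\<in>types N. psd_on (flag_index N \<tau>) (X \<tau>)) \<and>
     (\<forall>\<tau>\<in>types N - T. \<forall>F\<in>flag_index N \<tau>. \<forall>F'\<in>flag_index N \<tau>. X \<tau> F F' = 0) \<and>
     (\<forall>F\<in>unlabelled_graphs N. 0 \<le> c F) \<and>
     (\<exists>K. \<forall>\<^sub>F n in sequentially. \<forall>G :: nat graph. is_graph G \<and> card (verts G) = n \<longrightarrow>
        \<bar>(\<Sum>F\<in>unlabelled_graphs N. (u - edge_density \<kappa> l F) * real (graph_count F G))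
         - ((\<Sum>q\<in>type_sizes N. \<Sum>f\<in>{f \<in> {..<q} \<rightarrow>\<^sub>E verts G. inj_on f {..<q}}.
               flag_quadratic_form N (root_type q G f) (X (root_type q G f)) (G, f))
            + (\<Sum>F\<in>unlabelled_graphs N. c F * real (graph_count F G)))\<bar>
        \<le> K * real n ^ (N - 1))"

end

theory Submission
  imports Defs
begin

text \<open>The certificate uses only the two types on two roots \<open>x\<close>, \<open>y\<close> (edge and non-edge), and on both the
  same matrix of rank \<open>5\<close>, once the status of every pair is recorded relative to that of \<open>xy\<close>. Summed
  over the roots, the quadratic forms are, up to overlapping pairs, a sum over ordered
  six-tuples of vertices, so the claim becomes an inequality for every graph on six vertices. It is
  invariant under relabelling, hence only the \<open>936\<close> labelled graphs whose degree sequence is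
  nonincreasing have to be checked, which is done by rewriting. Positive semidefiniteness then turns
  the certificate into \<open>\<lambda>\<^sub>4\<^sub>,\<^sub>3(n) \<le> 1/2 + O(1/n)\<close>. For both patterns the density of the blowup with parts
  \<open>x\<close>, \<open>1 - x\<close> is \<open>4x(1 - x)(x\<^sup>2 + (1 - x)\<^sup>2) = 1/2 - 8(x - 1/2)\<^sup>4\<close>, which gives the lower bound
  and the unique maximizer.\<close>

section \<open>Subsets of fixed size and lists of distinct elements\<close>

text \<open>A 4-set has six pairs, so spanning three edges is a self-complementary condition, and
  the two patterns are complements of each other; this is why statuses relative to \<open>xy\<close>
  suffice. A bound attained in the limit forces the quadratic forms to vanish to leading order on
  the balanced blowups. The features do more: on two cliques of relative sizes x and 1 - x, with
  fixed roots, the first coordinate averages in the limit to (2x - 1)^2 or its negative over z and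
  t, the other four to 0. With first weight 112 the certificate is tight on both families for every
  x, because 112 (2x - 1)^4 / 224 = 8 (x - 1/2)^4. The formal obstacle is that unlabelled graphs and
  flags are representatives picked by \<open>SOME\<close>, so matrix entries cannot be listed. The
  matrix is therefore built from products of isomorphism-invariant functions of flags, and sums over
  representatives weighted by counts become sums over subsets of the vertices of G, with no
  representative ever identified. The coefficients \<open>c\<close> are defined as the slack of the
  six-vertex inequality.\<close>

definition ksubsets :: "nat \<Rightarrow> 'a set \<Rightarrow> 'a set set" where
  "ksubsets k A = {S. S \<subseteq> A \<and> card S = k}"

lemma finite_ksubsets: "finite A \<Longrightarrow> finite (ksubsets k A)"
  by (simp add: ksubsets_def)

lemma card_ksubsets: "finite A \<Longrightarrow> card (ksubsets k A) = card A choose k"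
  by (simp add: ksubsets_def n_subsets)

lemma ksubsets_0: "finite A \<Longrightarrow> ksubsets 0 A = {{}}"
  by (auto simp: ksubsets_def dest: finite_subset)

lemma ksubsets_empty: "ksubsets (Suc k) {} = {}"
  by (auto simp: ksubsets_def)

lemma ksubsets_insert:
  assumes "finite A" "a \<notin> A"
  shows "ksubsets (Suc k) (insert a A) = ksubsets (Suc k) A \<union> insert a ` ksubsets k A"
proof (rule equalityI; rule subsetI)
  fix S assume S: "S \<in> ksubsets (Suc k) (insert a A)"
  then have "finite S" using assms by (auto simp: ksubsets_def dest: finite_subset)
  show "S \<in> ksubsets (Suc k) A \<union> insert a ` ksubsets k A"
  proof (cases "a \<in> S")
    case True
    then have "S = insert a (S - {a})" "S - {a} \<in> ksubsets k A"
      using S \<open>finite S\<close> by (auto simp: ksubsets_def card_Diff_singleton)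
    then show ?thesis by blast
  next
    case False
    then show ?thesis using S by (auto simp: ksubsets_def)
  qed
next
  fix S assume "S \<in> ksubsets (Suc k) A \<union> insert a ` ksubsets k A"
  then show "S \<in> ksubsets (Suc k) (insert a A)"
  proof
    assume "S \<in> insert a ` ksubsets k A"
    then obtain T where T: "S = insert a T" "T \<subseteq> A" "card T = k" by (auto simp: ksubsets_def)
    moreover have "finite T" "a \<notin> T" using T assms by (auto dest: finite_subset)
    ultimately show ?thesis by (auto simp: ksubsets_def)
  qed (auto simp: ksubsets_def)
qed

text \<open>Together with \<open>ksubsets_0\<close> and \<open>ksubsets_empty\<close> this is a
  recursion that unfolds a sum over the subsets of an explicitly listed set, such as the 15
  four-subsets of a six-set.\<close>

lemma sum_ksubsets_insert:
  fixes g :: "'a set \<Rightarrow> 'b::comm_monoid_add"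
  assumes "finite A" "a \<notin> A"
  shows "(\<Sum>S\<in>ksubsets (Suc k) (insert a A). g S)
       = (\<Sum>S\<in>ksubsets (Suc k) A. g S) + (\<Sum>S\<in>ksubsets k A. g (insert a S))"
proof -
  have inj: "inj_on (insert a) (ksubsets k A)"
  proof (rule inj_onI)
    fix S T assume "S \<in> ksubsets k A" "T \<in> ksubsets k A" "insert a S = insert a T"
    then show "S = T" using assms(2) insert_ident[of a S T] by (auto simp: ksubsets_def)
  qed
  have "ksubsets (Suc k) A \<inter> insert a ` ksubsets k A = {}"
    using assms(2) by (auto simp: ksubsets_def)
  then show ?thesis
    using assms by (simp add: ksubsets_insert sum.union_disjoint finite_ksubsets sum.reindex[OF inj])
qed

section \<open>Sums over ordered tuples of distinct elements\<close>

definition distinct_lists :: "nat \<Rightarrow> 'a set \<Rightarrow> 'a list set" where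
  "distinct_lists n A = {xs. length xs = n \<and> distinct xs \<and> set xs \<subseteq> A}"

lemma finite_distinct_lists: "finite A \<Longrightarrow> finite (distinct_lists n A)"
  by (rule finite_subset[OF _ finite_lists_length_eq[of A n]]) (auto simp: distinct_lists_def)

lemma distinct_lists_0: "distinct_lists 0 A = {[]}"
  by (auto simp: distinct_lists_def)

text \<open>Used with 6 = 2 + 2 + 2: a six-tuple is a pair of roots followed by two disjoint pairs
  of further vertices. This is the shape in which it is compared with the square of a sum over
  pairs.\<close>

lemma sum_distinct_lists_append:
  fixes g :: "'a list \<Rightarrow> 'b::comm_monoid_add"
  assumes "finite A"
  shows "(\<Sum>xs\<in>distinct_lists (m + n) A. g xs)
       = (\<Sum>us\<in>distinct_lists m A. \<Sum>vs\<in>distinct_lists n (A - set us). g (us @ vs))"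
proof -
  let ?T = "SIGMA us:distinct_lists m A. distinct_lists n (A - set us)"
  have "(\<Sum>us\<in>distinct_lists m A. \<Sum>vs\<in>distinct_lists n (A - set us). g (us @ vs))
      = (\<Sum>(us, vs)\<in>?T. g (us @ vs))"
    using assms by (simp add: sum.Sigma finite_distinct_lists)
  also have "\<dots> = (\<Sum>xs\<in>distinct_lists (m + n) A. g xs)"
  proof (rule sum.reindex_bij_witness[where i = "\<lambda>xs. (take m xs, drop m xs)"
        and j = "\<lambda>(us, vs). us @ vs"], goal_cases)
    case (1 a)
    then show ?case by (auto simp: distinct_lists_def)
  next
    case (2 a)
    then show ?case by (auto simp: distinct_lists_def)
  next
    case (3 xs)
    then show ?case by simp
  next
    case (4 xs)
    then have xs: "length xs = m + n" "distinct (take m xs @ drop m xs)" "set xs \<subseteq> A"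
      by (simp_all only: distinct_lists_def mem_Collect_eq append_take_drop_id)
    have "set (take m xs) \<subseteq> A" "set (drop m xs) \<subseteq> A"
      using xs(3) set_take_subset[of m xs] set_drop_subset[of m xs] by blast+
    moreover have "set (take m xs) \<inter> set (drop m xs) = {}"
      using xs(2) by (simp only: distinct_append)
    ultimately show ?case using xs(1,2) by (auto simp: distinct_lists_def)
  next
    case (5 a)
    then show ?case by (simp add: case_prod_beta)
  qed
  finally show ?thesis by simp
qed

lemma sum_distinct_lists_Suc:
  fixes g :: "'a list \<Rightarrow> 'b::comm_monoid_add"
  assumes "finite A"
  shows "(\<Sum>xs\<in>distinct_lists (Suc n) A. g xs)
       = (\<Sum>x\<in>A. \<Sum>xs\<in>distinct_lists n (A - {x}). g (x # xs))"
proof -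
  have "(\<Sum>us\<in>distinct_lists 1 A. h us) = (\<Sum>x\<in>A. h [x])" for h :: "'a list \<Rightarrow> 'b"
    by (rule sum.reindex_bij_witness[where i = "\<lambda>x. [x]" and j = hd])
      (auto simp: distinct_lists_def length_Suc_conv)
  from this[of "\<lambda>us. \<Sum>vs\<in>distinct_lists n (A - set us). g (us @ vs)"] show ?thesis
    using sum_distinct_lists_append[OF assms, where m = 1 and n = n and g = g] by simp
qed

lemma card_distinct_lists_2:
  assumes "finite A"
  shows "card (distinct_lists 2 A) = card A * (card A - 1)"
proof -
  have one: "card (distinct_lists (Suc 0) B) = card B" if "finite B" for B :: "'a set"
    using sum_distinct_lists_Suc[OF that, where n = 0 and g = "\<lambda>_. 1::nat"]
    by (simp add: distinct_lists_0)
  have "card (distinct_lists (Suc (Suc 0)) A) = (\<Sum>x\<in>A. card (A - {x}))"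
    using sum_distinct_lists_Suc[OF assms, where n = "Suc 0" and g = "\<lambda>_. 1::nat"] assms
    by (simp only: sum_constant finite_Diff one of_nat_id mult_1_right)
  also have "\<dots> = card A * (card A - 1)"
    using assms by (simp add: card_Diff_singleton)
  finally show ?thesis by (simp only: numeral_2_eq_2)
qed

text \<open>A list of n distinct elements of an n-set exhausts it, so grouping by the set of entries
  loses nothing. With n = 2 it recovers ordered pairs from the unordered extensions of a flag, with
  n = 6 it splits a sum over six-tuples into induced subgraphs.\<close>

lemma sum_distinct_lists_by_set:
  fixes g :: "'a list \<Rightarrow> 'b::comm_monoid_add"
  assumes "finite A"
  shows "(\<Sum>xs\<in>distinct_lists n A. g xs) = (\<Sum>S\<in>ksubsets n A. \<Sum>xs\<in>distinct_lists n S. g xs)"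
proof -
  have "{xs \<in> distinct_lists n A. set xs = S} = distinct_lists n S" if "S \<in> ksubsets n A" for S
  proof -
    have "finite S" using that assms by (auto simp: ksubsets_def dest: finite_subset)
    moreover have "card S = n" "S \<subseteq> A" using that by (auto simp: ksubsets_def)
    ultimately have "set xs = S" if "xs \<in> distinct_lists n S" for xs
      using that card_subset_eq[of S "set xs"] by (simp add: distinct_lists_def distinct_card)
    moreover have "xs \<in> distinct_lists n A" if "xs \<in> distinct_lists n S" for xs
      using that \<open>S \<subseteq> A\<close> by (auto simp: distinct_lists_def)
    moreover have "xs \<in> distinct_lists n S" if "xs \<in> distinct_lists n A" "set xs = S" for xs
      using that by (simp add: distinct_lists_def)
    ultimately show ?thesis by blast
  qed
  moreover have "set ` distinct_lists n A \<subseteq> ksubsets n A"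
    by (auto simp: distinct_lists_def ksubsets_def distinct_card)
  ultimately show ?thesis
    using sum.group[where S = "distinct_lists n A" and T = "ksubsets n A" and g = set and h = g]
      finite_distinct_lists[OF assms] finite_ksubsets[OF assms]
    by (simp cong: sum.cong)
qed

section \<open>Counting induced subgraphs and flags up to isomorphism\<close>

lemma is_iso_id: "is_iso id G G"
  by (simp add: is_iso_def)

lemma is_iso_comp:
  assumes "is_iso \<phi> G H" "is_iso \<psi> H K"
  shows "is_iso (\<psi> \<circ> \<phi>) G K"
  using assms unfolding is_iso_def
  by (auto intro: bij_betw_trans dest: bij_betwE)

lemma is_iso_inv_into:
  assumes "is_iso \<phi> G H"
  shows "is_iso (inv_into (verts G) \<phi>) H G"
proof -
  have bij: "bij_betw \<phi> (verts G) (verts H)" using assms by (simp add: is_iso_def)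
  have "inv_into (verts G) \<phi> x \<in> verts G" "\<phi> (inv_into (verts G) \<phi> x) = x" if "x \<in> verts H" for x
    using that bij by (auto simp: bij_betw_def inv_into_into f_inv_into_f)
  then show ?thesis
    using assms bij_betw_inv_into[OF bij] by (simp add: is_iso_def)
qed

lemma isomorphic_refl: "isomorphic G G"
  using is_iso_id isomorphic_def by blast

lemma isomorphic_sym: "isomorphic G H \<Longrightarrow> isomorphic H G"
  unfolding isomorphic_def by (metis is_iso_inv_into)

lemma isomorphic_trans: "isomorphic G H \<Longrightarrow> isomorphic H K \<Longrightarrow> isomorphic G K"
  unfolding isomorphic_def by (metis is_iso_comp)

definition is_flag :: "nat \<Rightarrow> 'a flag \<Rightarrow> bool" where
  "is_flag q F \<longleftrightarrow> is_graph (fst F) \<and> snd F ` {..<q} \<subseteq> verts (fst F) \<and> inj_on (snd F) {..<q}"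

lemma flag_isomorphic_refl: "flag_isomorphic q F F"
  unfolding flag_isomorphic_def by (rule exI[of _ id]) (simp add: is_iso_id)

text \<open>\<open>is_flag\<close> places the roots among the vertices, where
  \<open>inv_into\<close> inverts the isomorphism and so returns the roots of \<open>H\<close> to
  those of \<open>F\<close>.\<close>

lemma flag_isomorphic_sym:
  assumes "is_flag q F" "flag_isomorphic q F H"
  shows "flag_isomorphic q H F"
proof -
  obtain \<phi> where \<phi>: "is_iso \<phi> (fst F) (fst H)" "\<forall>i<q. \<phi> (snd F i) = snd H i"
    using assms(2) by (auto simp: flag_isomorphic_def)
  have "inv_into (verts (fst F)) \<phi> (snd H i) = snd F i" if "i < q" for i
  proof -
    have "snd F i \<in> verts (fst F)" using assms(1) that by (auto simp: is_flag_def)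
    moreover have "inj_on \<phi> (verts (fst F))" using \<phi>(1) by (simp add: is_iso_def bij_betw_def)
    ultimately show ?thesis using \<phi>(2) that by (metis inv_into_f_f)
  qed
  then show ?thesis
    unfolding flag_isomorphic_def using is_iso_inv_into[OF \<phi>(1)] by blast
qed

lemma flag_isomorphic_trans:
  assumes "flag_isomorphic q F H" "flag_isomorphic q H K"
  shows "flag_isomorphic q F K"
proof -
  obtain \<phi> \<psi> where "is_iso \<phi> (fst F) (fst H)" "\<forall>i<q. \<phi> (snd F i) = snd H i"
    "is_iso \<psi> (fst H) (fst K)" "\<forall>i<q. \<psi> (snd H i) = snd K i"
    using assms by (auto simp: flag_isomorphic_def)
  then have "is_iso (\<psi> \<circ> \<phi>) (fst F) (fst K)" "\<forall>i<q. (\<psi> \<circ> \<phi>) (snd F i) = snd K i"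
    by (auto intro: is_iso_comp)
  then show ?thesis unfolding flag_isomorphic_def by blast
qed

section \<open>Representatives of isomorphism classes and sums over them\<close>

lemma representatives_subset:
  assumes "\<And>x. x \<in> A \<Longrightarrow> R x x"
  shows "representatives R A \<subseteq> A"
proof -
  have "(SOME y. y \<in> A \<and> R x y) \<in> A" if "x \<in> A" for x
    using someI[of "\<lambda>y. y \<in> A \<and> R x y" x] that assms by blast
  then show ?thesis by (auto simp: representatives_def)
qed

text \<open>Equivalent elements hand equivalent predicates to \<open>SOME\<close>, so they receive
  literally the same representative.\<close>

lemma representatives_unique:
  assumes x: "x \<in> A"
    and refl: "\<And>x. x \<in> A \<Longrightarrow> R x x"
    and sym: "\<And>x y. x \<in> A \<Longrightarrow> y \<in> A \<Longrightarrow> R x y \<Longrightarrow> R y x"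
    and trans: "\<And>x y z. x \<in> A \<Longrightarrow> y \<in> A \<Longrightarrow> z \<in> A \<Longrightarrow> R x y \<Longrightarrow> R y z \<Longrightarrow> R x z"
  shows "\<exists>!y. y \<in> representatives R A \<and> R x y"
proof -
  define rep where "rep x = (SOME y. y \<in> A \<and> R x y)" for x
  have rep: "rep z \<in> A \<and> R z (rep z)" if "z \<in> A" for z
    unfolding rep_def using someI[of "\<lambda>y. y \<in> A \<and> R z y" z] that refl by blast
  show ?thesis
  proof (rule ex1I[of _ "rep x"])
    show "rep x \<in> representatives R A \<and> R x (rep x)"
      using rep[OF x] x by (auto simp: representatives_def rep_def)
  next
    fix y assume y: "y \<in> representatives R A \<and> R x y"
    then obtain z where z: "z \<in> A" "y = rep z" by (auto simp: representatives_def rep_def)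
    have "R x z" using rep[OF z(1)] x z y sym trans by metis
    then have "(w \<in> A \<and> R x w) \<longleftrightarrow> (w \<in> A \<and> R z w)" for w
      using x z(1) sym trans by metis
    then show "y = rep x" by (simp add: z rep_def)
  qed
qed

text \<open>Double counting: each \<open>s\<close> is counted for exactly one class
  \<open>a\<close>, where it contributes \<open>\<phi> a\<close>. Here \<open>S\<close> will consist
  of vertex sets of a large graph and \<open>R\<close> of chosen representatives, so the right-hand
  side no longer depends on the choice.\<close>

lemma sum_over_classes:
  fixes \<phi> :: "'b \<Rightarrow> real"
  assumes "finite S" "finite R"
    and ex1: "\<And>s. s \<in> S \<Longrightarrow> \<exists>!a. a \<in> R \<and> Q s a"
    and eq: "\<And>s a. s \<in> S \<Longrightarrow> a \<in> R \<Longrightarrow> Q s a \<Longrightarrow> \<psi> s = \<phi> a"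
  shows "(\<Sum>a\<in>R. \<phi> a * real (card {s \<in> S. Q s a})) = (\<Sum>s\<in>S. \<psi> s)"
proof -
  have "(\<Sum>a\<in>R. \<phi> a * real (card {s \<in> S. Q s a})) = (\<Sum>a\<in>R. \<Sum>s\<in>S. if Q s a then \<phi> a else 0)"
    using assms(1) by (intro sum.cong) (simp_all add: sum.If_cases Int_def mult.commute)
  also have "\<dots> = (\<Sum>s\<in>S. \<Sum>a\<in>R. if Q s a then \<phi> a else 0)"
    by (rule sum.swap)
  also have "\<dots> = (\<Sum>s\<in>S. \<psi> s)"
  proof (rule sum.cong)
    fix s assume s: "s \<in> S"
    then obtain a where a: "a \<in> R" "Q s a" "\<And>b. b \<in> R \<Longrightarrow> Q s b \<Longrightarrow> b = a"
      using ex1 by metis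
    then have "(if Q s b then \<phi> b else 0) = (if b = a then \<phi> a else 0)" if "b \<in> R" for b
      using that by metis
    then have "(\<Sum>b\<in>R. if Q s b then \<phi> b else 0) = (\<Sum>b\<in>R. if b = a then \<phi> a else 0)"
      by (rule sum.cong[OF refl])
    then show "(\<Sum>b\<in>R. if Q s b then \<phi> b else 0) = \<psi> s"
      using a(1) eq[OF s a(1,2)] assms(2) by simp
  qed simp
  finally show ?thesis .
qed

lemma is_graph_induced: "is_graph G \<Longrightarrow> S \<subseteq> verts G \<Longrightarrow> is_graph (induced G S)"
  by (auto simp: is_graph_def induced_def dest: finite_subset)

lemma finite_graphs_on: "finite (graphs_on n)"
proof (rule finite_subset)
  show "graphs_on n \<subseteq> {{..<n}} \<times> Pow (Pow {..<n})"
  proof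
    fix G assume "G \<in> graphs_on n"
    then have "verts G = {..<n}" "edges G \<subseteq> Pow {..<n}"
      by (auto simp: graphs_on_def is_graph_def)
    then show "G \<in> {{..<n}} \<times> Pow (Pow {..<n})" by (simp add: mem_Times_iff)
  qed
qed simp

lemma exists_labelled_copy:
  assumes "is_graph G" "card (verts G) = n"
  obtains F \<phi> where "F \<in> graphs_on n" "is_iso \<phi> G F"
proof -
  have fin: "finite (verts G)" using assms(1) by (simp add: is_graph_def)
  then obtain \<phi> where \<phi>: "bij_betw \<phi> (verts G) {..<n}"
    using assms(2) ex_bij_betw_finite_nat[OF fin] by (auto simp: atLeast0LessThan)
  then have inj: "inj_on \<phi> (verts G)" and img: "\<phi> ` verts G = {..<n}" by (auto simp: bij_betw_def)
  define F where "F = ({..<n}, (`) \<phi> ` edges G)"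
  have edge: "e \<subseteq> verts G" "card e = 2" if "e \<in> edges G" for e
    using assms(1) that by (auto simp: is_graph_def)
  have "F \<in> graphs_on n"
    using edge img inj by (fastforce simp: graphs_on_def is_graph_def F_def card_image inj_on_subset)
  moreover have "{\<phi> x, \<phi> y} \<in> (`) \<phi> ` edges G \<longleftrightarrow> {x, y} \<in> edges G"
    if "x \<in> verts G" "y \<in> verts G" for x y
  proof
    assume "{\<phi> x, \<phi> y} \<in> (`) \<phi> ` edges G"
    then obtain e where e: "e \<in> edges G" "\<phi> ` {x, y} = \<phi> ` e" by auto
    then have "{x, y} = e"
      using inj_on_image_eq_iff[OF inj, of "{x, y}" e] that edge(1)[OF e(1)] by simp
    then show "{x, y} \<in> edges G" using e by simp
  next
    assume "{x, y} \<in> edges G"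
    then show "{\<phi> x, \<phi> y} \<in> (`) \<phi> ` edges G" by (rule rev_image_eqI) simp
  qed
  ultimately show ?thesis
    using that[of F \<phi>] \<phi> by (simp add: is_iso_def F_def)
qed

lemma sum_graph_count:
  fixes G :: "nat graph" and \<phi> :: "nat graph \<Rightarrow> real"
  assumes G: "is_graph G"
    and inv: "\<And>F H. is_graph F \<Longrightarrow> is_graph H \<Longrightarrow> isomorphic F H \<Longrightarrow> \<phi> F = \<phi> H"
  shows "(\<Sum>F\<in>unlabelled_graphs N. \<phi> F * real (graph_count F G))
       = (\<Sum>S\<in>ksubsets N (verts G). \<phi> (induced G S))"
proof -
  have sub: "unlabelled_graphs N \<subseteq> graphs_on N"
    unfolding unlabelled_graphs_def by (rule representatives_subset) (rule isomorphic_refl)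
  have "real (graph_count F G) = real (card {S \<in> ksubsets N (verts G). isomorphic (induced G S) F})"
    if "F \<in> unlabelled_graphs N" for F
  proof -
    have "card (verts F) = N" using that sub by (auto simp: graphs_on_def)
    then show ?thesis by (simp add: graph_count_def ksubsets_def conj_assoc)
  qed
  then have "(\<Sum>F\<in>unlabelled_graphs N. \<phi> F * real (graph_count F G))
     = (\<Sum>F\<in>unlabelled_graphs N. \<phi> F *
          real (card {S \<in> ksubsets N (verts G). isomorphic (induced G S) F}))"
    by simp
  also have "\<dots> = (\<Sum>S\<in>ksubsets N (verts G). \<phi> (induced G S))"
  proof (rule sum_over_classes)
    show "finite (ksubsets N (verts G))" using G by (simp add: finite_ksubsets is_graph_def)
    show "finite (unlabelled_graphs N)" using sub finite_graphs_on finite_subset by blast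
  next
    fix S assume S: "S \<in> ksubsets N (verts G)"
    then have "is_graph (induced G S)" "card (verts (induced G S)) = N"
      using G by (auto simp: ksubsets_def induced_def intro: is_graph_induced[unfolded induced_def])
    then obtain F where F: "F \<in> graphs_on N" "isomorphic (induced G S) F"
      using exists_labelled_copy isomorphic_def by metis
    \<comment> \<open>The induced subgraph has arbitrary vertices, whereas representatives live on
      an initial segment; its labelled copy \<open>F\<close> has the same isomorphic partners and
      belongs to the set on which representatives are unique.\<close>
    have "isomorphic (induced G S) H \<longleftrightarrow> isomorphic F H" for H :: "nat graph"
      using F(2) isomorphic_sym isomorphic_trans by blast
    moreover have "\<exists>!H. H \<in> unlabelled_graphs N \<and> isomorphic F H"
      unfolding unlabelled_graphs_def
      by (rule representatives_unique[OF F(1)]) (blast intro: isomorphic_refl isomorphic_sym isomorphic_trans)+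
    ultimately show "\<exists>!H. H \<in> unlabelled_graphs N \<and> isomorphic (induced G S) H" by simp
  next
    fix S F assume "S \<in> ksubsets N (verts G)" "F \<in> unlabelled_graphs N" "isomorphic (induced G S) F"
    then show "\<phi> (induced G S) = \<phi> F"
      using sub G by (intro inv) (auto simp: graphs_on_def ksubsets_def intro: is_graph_induced)
  qed
  finally show ?thesis .
qed

lemma root_type_edge:
  assumes "i < q" "j < q"
  shows "{i, j} \<in> edges (root_type q G f) \<longleftrightarrow> {f i, f j} \<in> edges G"
proof
  assume "{i, j} \<in> edges (root_type q G f)"
  then obtain a b where "{i, j} = {a, b}" "{f a, f b} \<in> edges G"
    by (auto simp: root_type_def)
  then show "{f i, f j} \<in> edges G" by (auto simp: doubleton_eq_iff insert_commute)
qed (use assms in \<open>auto simp: root_type_def\<close>)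

lemma root_type_in_graphs_on:
  assumes "is_graph G"
  shows "root_type q G f \<in> graphs_on q"
proof -
  have "i \<noteq> j" if "{f i, f j} \<in> edges G" for i j
    using assms that by (auto simp: is_graph_def)
  then show ?thesis by (fastforce simp: graphs_on_def is_graph_def root_type_def card_insert_if)
qed

text \<open>The rooted counterpart of \<open>sum_graph_count\<close>: instead of flags, the sum runs
  over the (s - q)-sets that extend the roots inside G.\<close>

lemma sum_flag_count:
  fixes G :: "nat graph" and \<phi> :: "nat flag \<Rightarrow> real"
  assumes G: "is_graph G" and f: "f \<in> {..<q} \<rightarrow>\<^sub>E verts G" "inj_on f {..<q}" and "q \<le> s"
    and inv: "\<And>F H. is_flag q F \<Longrightarrow> is_flag q H \<Longrightarrow> flag_isomorphic q F H \<Longrightarrow> \<phi> F = \<phi> H"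
  shows "(\<Sum>F\<in>unlabelled_flags (root_type q G f) s. \<phi> F * real (flag_count q F (G, f)))
       = (\<Sum>X\<in>ksubsets (s - q) (verts G - f ` {..<q}). \<phi> (induced G (X \<union> f ` {..<q}), f))"
proof -
  let ?\<tau> = "root_type q G f"
  define A where "A = {(F, f). F \<in> graphs_on s \<and> embedding ?\<tau> F f}"
  have vert: "verts ?\<tau> = {..<q}" by (simp add: root_type_def)
  have reps: "unlabelled_flags ?\<tau> s = representatives (flag_isomorphic q) A"
    by (simp add: unlabelled_flags_def A_def vert)
  have flagA: "is_flag q F" if "F \<in> A" for F
    using that by (auto simp: A_def is_flag_def graphs_on_def embedding_def vert)
  have sub: "unlabelled_flags ?\<tau> s \<subseteq> A"
    unfolding reps by (rule representatives_subset) (rule flag_isomorphic_refl)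
  have "A \<subseteq> graphs_on s \<times> ({..<q} \<rightarrow>\<^sub>E {..<s})"
    by (auto simp: A_def embedding_def vert graphs_on_def)
  then have finA: "finite A"
    by (rule finite_subset) (simp add: finite_graphs_on finite_PiE)
  let ?K = "ksubsets (s - q) (verts G - f ` {..<q})"
  let ?H = "\<lambda>X. (induced G (X \<union> f ` {..<q}), f)"
  have fV: "f ` {..<q} \<subseteq> verts G" using f by auto
  have flagK: "is_flag q (?H X)" if "X \<in> ?K" for X
    using that G f fV
    by (auto simp: is_flag_def ksubsets_def induced_def intro!: is_graph_induced[unfolded induced_def])
  have "real (flag_count q F (G, f)) = real (card {X \<in> ?K. flag_isomorphic q (?H X) F})"
    if "F \<in> unlabelled_flags ?\<tau> s" for F
  proof -
    have "card (verts (fst F)) = s" using that sub by (auto simp: A_def graphs_on_def)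
    then show ?thesis by (simp add: flag_count_def ksubsets_def conj_assoc)
  qed
  then have "(\<Sum>F\<in>unlabelled_flags ?\<tau> s. \<phi> F * real (flag_count q F (G, f)))
     = (\<Sum>F\<in>unlabelled_flags ?\<tau> s. \<phi> F * real (card {X \<in> ?K. flag_isomorphic q (?H X) F}))"
    by simp
  also have "\<dots> = (\<Sum>X\<in>?K. \<phi> (?H X))"
  proof (rule sum_over_classes)
    show "finite ?K" using G by (simp add: finite_ksubsets is_graph_def)
    show "finite (unlabelled_flags ?\<tau> s)" using sub finA finite_subset by blast
  next
    fix X assume X: "X \<in> ?K"
    have "finite X" using X G by (auto simp: ksubsets_def is_graph_def dest: finite_subset)
    moreover have "X \<inter> f ` {..<q} = {}" "card X = s - q" using X by (auto simp: ksubsets_def)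
    ultimately have "card (verts (induced G (X \<union> f ` {..<q}))) = s"
      using f(2) \<open>q \<le> s\<close> by (simp add: induced_def card_Un_disjoint card_image)
    moreover have "is_graph (induced G (X \<union> f ` {..<q}))"
      using flagK[OF X] by (simp add: is_flag_def)
    ultimately obtain F \<phi> where F: "F \<in> graphs_on s" "is_iso \<phi> (induced G (X \<union> f ` {..<q})) F"
      using exists_labelled_copy by metis
    \<comment> \<open>The restriction is needed because \<open>embedding\<close> asks for an
      extensional root map.\<close>
    define h where "h = restrict (\<phi> \<circ> f) {..<q}"
    have V: "verts (induced G (X \<union> f ` {..<q})) = X \<union> f ` {..<q}" by (simp add: induced_def)
    have bij: "bij_betw \<phi> (X \<union> f ` {..<q}) {..<s}"
      using F by (simp add: is_iso_def V graphs_on_def)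
    have iso: "flag_isomorphic q (?H X) (F, h)"
      unfolding flag_isomorphic_def by (rule exI[of _ \<phi>]) (use F(2) in \<open>simp add: h_def\<close>)
    have "{i, j} \<in> edges ?\<tau> \<longleftrightarrow> {h i, h j} \<in> edges F" if "i < q" "j < q" for i j
    proof -
      have "{h i, h j} \<in> edges F \<longleftrightarrow> {f i, f j} \<in> edges (induced G (X \<union> f ` {..<q}))"
        using F(2) that by (simp add: is_iso_def V h_def)
      then show ?thesis using that by (simp add: root_type_edge induced_def)
    qed
    moreover have "h \<in> {..<q} \<rightarrow>\<^sub>E {..<s}"
      using bij by (auto simp: h_def bij_betw_def)
    moreover have "inj_on h {..<q}"
    proof (rule inj_onI)
      fix i j assume "i \<in> {..<q}" "j \<in> {..<q}" "h i = h j"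
      then have "f i = f j" using bij by (auto simp: h_def bij_betw_def dest: inj_onD)
      then show "i = j" using f(2) \<open>i \<in> {..<q}\<close> \<open>j \<in> {..<q}\<close> by (auto dest: inj_onD)
    qed
    ultimately have Fh: "(F, h) \<in> A"
      using F(1) by (auto simp: A_def embedding_def vert graphs_on_def)
    have "flag_isomorphic q (?H X) H \<longleftrightarrow> flag_isomorphic q (F, h) H" for H :: "nat flag"
      using iso flag_isomorphic_sym[OF flagK[OF X] iso] flag_isomorphic_trans by blast
    moreover have "\<exists>!H. H \<in> unlabelled_flags ?\<tau> s \<and> flag_isomorphic q (F, h) H"
      unfolding reps
      by (rule representatives_unique[OF Fh])
        (blast intro: flag_isomorphic_refl flag_isomorphic_sym flag_isomorphic_trans flagA)+
    ultimately show "\<exists>!H. H \<in> unlabelled_flags ?\<tau> s \<and> flag_isomorphic q (?H X) H" by simp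
  next
    fix X F assume "X \<in> ?K" "F \<in> unlabelled_flags ?\<tau> s" "flag_isomorphic q (?H X) F"
    then show "\<phi> (?H X) = \<phi> F"
      using inv[of "?H X" F] sub flagA[of F] flagK[of X] by blast
  qed
  finally show ?thesis .
qed

section \<open>An inequality for graphs on six vertices\<close>

text \<open>For roots \<open>x\<close>, \<open>y\<close> and further vertices \<open>z\<close>, \<open>t\<close>, the arguments \<open>p\<close>, \<open>q\<close>, \<open>r\<close>, \<open>s\<close>, \<open>w\<close> tell
  whether \<open>xz\<close>, \<open>yz\<close>, \<open>xt\<close>, \<open>yt\<close>, \<open>zt\<close> have the same status (edge or non-edge) as \<open>xy\<close>, so the
  feature vector does not change when the graph is complemented. The entries were found by rounding
  a numerical solution of the semidefinite program of the certificate.\<close>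

definition feature_of :: "int \<Rightarrow> int \<Rightarrow> bool \<Rightarrow> int list" where
  "feature_of m d w =
    (if w then [1, 0, m * (d * d - 2), m * (3 - d), m * (3 * d - 1)]
     else [-1, d, - m * d * (2 * d + 1), m * d, 5 * m * d])"

text \<open>The first argument passed on, m, changes sign when the roots are exchanged, and the
  second, d, does not; both are unchanged when z and t are exchanged. Thus the first two entries of
  \<open>feature_of\<close> are even and the last three odd under exchanging the roots.\<close>

definition feature :: "bool \<Rightarrow> bool \<Rightarrow> bool \<Rightarrow> bool \<Rightarrow> bool \<Rightarrow> int list" where
  "feature p q r s w =
    feature_of (of_bool q - of_bool p + of_bool s - of_bool r)
      (of_bool p + of_bool q + of_bool r + of_bool s - 2) w"

text \<open>The scale is fixed by 224 = 2 * 112: for a complete graph on six vertices every feature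
  is [1, 0, 0, 0, 0], and the average 112 equals 224 times the deficit 1/2.\<close>

definition weights :: "int list" where
  "weights = [112, 112, 16, 17, 7]"

fun weighted_inner :: "int list \<Rightarrow> int list \<Rightarrow> int list \<Rightarrow> int" where
  "weighted_inner (w # ws) (x # xs) (y # ys) = w * x * y + weighted_inner ws xs ys"
| "weighted_inner _ _ _ = 0"

lemma weighted_inner_commute: "weighted_inner ws xs ys = weighted_inner ws ys xs"
  by (induction ws xs ys rule: weighted_inner.induct) (auto simp: mult.commute mult.left_commute)

lemma feature_swap: "feature r s p q w = feature p q r s w"
  unfolding feature_def by (simp add: algebra_simps)

text \<open>Exchanging the roots negates m. The product is coordinatewise and each coordinate is
  either even or odd in m, so the signs cancel in every summand.\<close>

lemma weighted_inner_swap_roots: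
  "weighted_inner weights (feature q p s r w) (feature q' p' s' r' w')
   = weighted_inner weights (feature p q r s w) (feature p' q' r' s' w')"
proof -
  have neg: "weighted_inner weights (feature_of (- m) d w) (feature_of (- m') d' w')
      = weighted_inner weights (feature_of m d w) (feature_of m' d' w')" for m d m' d'
    by (simp add: feature_of_def weights_def)
  have swap: "feature q p s r w
      = feature_of (- (of_bool q - of_bool p + of_bool s - of_bool r))
          (of_bool p + of_bool q + of_bool r + of_bool s - 2) w" for p q r s w
    unfolding feature_def
    by (rule arg_cong2[where f = "\<lambda>m d. feature_of m d w"]) simp_all
  show ?thesis
    unfolding swap[of q p s r w] swap[of q' p' s' r' w'] neg
    by (simp only: feature_def)
qed

section \<open>The six-vertex inequality in terms of edge indicators\<close>

definition flag_product ::
  "bool \<Rightarrow> bool \<Rightarrow> bool \<Rightarrow> bool \<Rightarrow> bool \<Rightarrow> bool \<Rightarrow> bool \<Rightarrow> bool \<Rightarrow> bool \<Rightarrow> bool \<Rightarrow> bool \<Rightarrow> int" where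
  "flag_product xy xa ya xb yb ab xc yc xd yd cd =
    weighted_inner weights (feature (xa = xy) (ya = xy) (xb = xy) (yb = xy) (ab = xy))
      (feature (xc = xy) (yc = xy) (xd = xy) (yd = xy) (cd = xy))"

text \<open>The summands are the three ways to split the four remaining vertices into two pairs.
  Each stands for 8 of the 24 orderings: the order within either pair and the order of the
  pairs.\<close>

definition root_term ::
  "bool \<Rightarrow> bool \<Rightarrow> bool \<Rightarrow> bool \<Rightarrow> bool \<Rightarrow> bool \<Rightarrow> bool \<Rightarrow> bool \<Rightarrow> bool \<Rightarrow>
   bool \<Rightarrow> bool \<Rightarrow> bool \<Rightarrow> bool \<Rightarrow> bool \<Rightarrow> bool \<Rightarrow> int" where
  "root_term xy xa ya xb yb xc yc xd yd ab ac ad bc bd cd =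
    flag_product xy xa ya xb yb ab xc yc xd yd cd +
    flag_product xy xa ya xc yc ac xb yb xd yd bd +
    flag_product xy xa ya xd yd ad xb yb xc yc bc"

definition three :: "bool \<Rightarrow> bool \<Rightarrow> bool \<Rightarrow> bool \<Rightarrow> bool \<Rightarrow> bool \<Rightarrow> int" where
  "three a b c d e f =
    of_bool (of_bool a + of_bool b + of_bool c + of_bool d + of_bool e + of_bool f = (3::nat))"

text \<open>One summand per unordered pair of roots. Exchanging the roots gives a factor 2 besides
  the 8 orderings per splitting, so 45 products replace 720.\<close>

definition root_total ::
  "bool \<Rightarrow> bool \<Rightarrow> bool \<Rightarrow> bool \<Rightarrow> bool \<Rightarrow> bool \<Rightarrow> bool \<Rightarrow> bool \<Rightarrow> bool \<Rightarrow>
   bool \<Rightarrow> bool \<Rightarrow> bool \<Rightarrow> bool \<Rightarrow> bool \<Rightarrow> bool \<Rightarrow> int" where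
  "root_total e01 e02 e03 e04 e05 e12 e13 e14 e15 e23 e24 e25 e34 e35 e45 =
     root_term e01 e02 e12 e03 e13 e04 e14 e05 e15 e23 e24 e25 e34 e35 e45 +
     root_term e02 e01 e12 e03 e23 e04 e24 e05 e25 e13 e14 e15 e34 e35 e45 +
     root_term e03 e01 e13 e02 e23 e04 e34 e05 e35 e12 e14 e15 e24 e25 e45 +
     root_term e04 e01 e14 e02 e24 e03 e34 e05 e45 e12 e13 e15 e23 e25 e35 +
     root_term e05 e01 e15 e02 e25 e03 e35 e04 e45 e12 e13 e14 e23 e24 e34 +
     root_term e12 e01 e02 e13 e23 e14 e24 e15 e25 e03 e04 e05 e34 e35 e45 +
     root_term e13 e01 e03 e12 e23 e14 e34 e15 e35 e02 e04 e05 e24 e25 e45 +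
     root_term e14 e01 e04 e12 e24 e13 e34 e15 e45 e02 e03 e05 e23 e25 e35 +
     root_term e15 e01 e05 e12 e25 e13 e35 e14 e45 e02 e03 e04 e23 e24 e34 +
     root_term e23 e02 e03 e12 e13 e24 e34 e25 e35 e01 e04 e05 e14 e15 e45 +
     root_term e24 e02 e04 e12 e14 e23 e34 e25 e45 e01 e03 e05 e13 e15 e35 +
     root_term e25 e02 e05 e12 e15 e23 e35 e24 e45 e01 e03 e04 e13 e14 e34 +
     root_term e34 e03 e04 e13 e14 e23 e24 e35 e45 e01 e02 e05 e12 e15 e25 +
     root_term e35 e03 e05 e13 e15 e23 e25 e34 e45 e01 e02 e04 e12 e14 e24 +
     root_term e45 e04 e05 e14 e15 e24 e25 e34 e35 e01 e02 e03 e12 e13 e23"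

definition three_total ::
  "bool \<Rightarrow> bool \<Rightarrow> bool \<Rightarrow> bool \<Rightarrow> bool \<Rightarrow> bool \<Rightarrow> bool \<Rightarrow> bool \<Rightarrow> bool \<Rightarrow>
   bool \<Rightarrow> bool \<Rightarrow> bool \<Rightarrow> bool \<Rightarrow> bool \<Rightarrow> bool \<Rightarrow> int" where
  "three_total e01 e02 e03 e04 e05 e12 e13 e14 e15 e23 e24 e25 e34 e35 e45 =
     three e01 e02 e03 e12 e13 e23 + three e01 e02 e04 e12 e14 e24 +
     three e01 e02 e05 e12 e15 e25 + three e01 e03 e04 e13 e14 e34 +
     three e01 e03 e05 e13 e15 e35 + three e01 e04 e05 e14 e15 e45 +
     three e02 e03 e04 e23 e24 e34 + three e02 e03 e05 e23 e25 e35 +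
     three e02 e04 e05 e24 e25 e45 + three e03 e04 e05 e34 e35 e45 +
     three e12 e13 e14 e23 e24 e34 + three e12 e13 e15 e23 e25 e35 +
     three e12 e14 e15 e24 e25 e45 + three e13 e14 e15 e34 e35 e45 +
     three e23 e24 e25 e34 e35 e45"

text \<open>A list of \<open>15\<close> booleans encodes a graph on six vertices. Its prefixes of lengths \<open>9\<close>, \<open>12\<close>,
  \<open>14\<close>, \<open>15\<close> determine the degrees of the first two, three, four and all vertices; the search below
  abandons a prefix as soon as these degrees are not nonincreasing.\<close>

fun degrees_ok :: "bool list \<Rightarrow> bool" where
  "degrees_ok [e01, e02, e03, e04, e05, e12, e13, e14, e15] =
    (of_bool e01 + of_bool e12 + of_bool e13 + of_bool e14 + of_bool e15 \<le> (of_bool e01 + of_bool e02 + of_bool e03 + of_bool e04 + of_bool e05 :: nat))"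
| "degrees_ok [e01, e02, e03, e04, e05, e12, e13, e14, e15, e23, e24, e25] =
    (of_bool e02 + of_bool e12 + of_bool e23 + of_bool e24 + of_bool e25 \<le> (of_bool e01 + of_bool e12 + of_bool e13 + of_bool e14 + of_bool e15 :: nat))"
| "degrees_ok [e01, e02, e03, e04, e05, e12, e13, e14, e15, e23, e24, e25, e34, e35] =
    (of_bool e03 + of_bool e13 + of_bool e23 + of_bool e34 + of_bool e35 \<le> (of_bool e02 + of_bool e12 + of_bool e23 + of_bool e24 + of_bool e25 :: nat))"
| "degrees_ok [e01, e02, e03, e04, e05, e12, e13, e14, e15, e23, e24, e25, e34, e35, e45] =
    (of_bool e04 + of_bool e14 + of_bool e24 + of_bool e34 + of_bool e45 \<le> (of_bool e03 + of_bool e13 + of_bool e23 + of_bool e34 + of_bool e35 :: nat) \<and>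
     of_bool e05 + of_bool e15 + of_bool e25 + of_bool e35 + of_bool e45 \<le> (of_bool e04 + of_bool e14 + of_bool e24 + of_bool e34 + of_bool e45 :: nat))"
| "degrees_ok _ = True"

text \<open>The inequality sum / 161280 \<le> 1/2 - T / 15 with \<open>16 * root_total\<close> as
  the sum and \<open>three_total\<close> as T, cleared of denominators: 161280 / (16 * 2) = 5040 and
  161280 / (16 * 15) = 672. The search tests it only on complete codes; the default value concerns
  lists of other lengths.\<close>

fun code_ok :: "bool list \<Rightarrow> bool" where
  "code_ok [e01, e02, e03, e04, e05, e12, e13, e14, e15, e23, e24, e25, e34, e35, e45] =
    (root_total e01 e02 e03 e04 e05 e12 e13 e14 e15 e23 e24 e25 e34 e35 e45 + 672 * three_total e01 e02 e03 e04 e05 e12 e13 e14 e15 e23 e24 e25 e34 e35 e45 \<le> 5040)"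
| "code_ok _ = True"

text \<open>The unit list counts in unary the bits still to be chosen, and every extension is
  guarded by the degree test on the prefix.\<close>

fun search :: "unit list \<Rightarrow> bool list \<Rightarrow> bool" where
  "search [] bs = (if degrees_ok bs then code_ok bs else True)"
| "search (_ # us) bs =
    (if degrees_ok bs
     then if search us (bs @ [False]) then search us (bs @ [True]) else False
     else True)"

text \<open>The induction follows the single branch spelled by \<open>cs\<close>; since none of its
  prefixes fails the degree test, the branch is never abandoned and its leaf has been
  checked.\<close>

lemma search_sound:
  assumes "search us bs" "length cs = length us" "\<And>k. degrees_ok (bs @ take k cs)"
  shows "code_ok (bs @ cs)"
  using assms
proof (induction us arbitrary: bs cs)
  case Nil
  then show ?case using Nil(3)[of 0] by simp
next
  case (Cons u us)
  then obtain c cs' where cs: "cs = c # cs'" "length cs' = length us"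
    by (metis Suc_length_conv length_Cons)
  have "degrees_ok bs" using Cons.prems(3)[of 0] by simp
  then have "search us (bs @ [c])"
    using Cons.prems(1) by (cases c) (simp_all split: if_splits)
  moreover have "degrees_ok ((bs @ [c]) @ take k cs')" for k
    using Cons.prems(3)[of "Suc k"] by (simp add: cs)
  ultimately show ?case using Cons.IH[of "bs @ [c]" cs'] cs by simp
qed

lemma search_succeeds: "search (replicate 15 ()) []"
  by code_simp

section \<open>From edge indicators to graphs\<close>

abbreviation adj :: "'a graph \<Rightarrow> 'a \<Rightarrow> 'a \<Rightarrow> bool" where
  "adj G x y \<equiv> {x, y} \<in> edges G"

definition vertex_feature :: "('a \<Rightarrow> 'a \<Rightarrow> bool) \<Rightarrow> 'a \<Rightarrow> 'a \<Rightarrow> 'a \<Rightarrow> 'a \<Rightarrow> int list" where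
  "vertex_feature e x y z t =
    feature (e x z = e x y) (e y z = e x y) (e x t = e x y) (e y t = e x y) (e z t = e x y)"

definition feature_product :: "('a \<Rightarrow> 'a \<Rightarrow> bool) \<Rightarrow> 'a list \<Rightarrow> int" where
  "feature_product e p = weighted_inner weights
     (vertex_feature e (p ! 0) (p ! 1) (p ! 2) (p ! 3))
     (vertex_feature e (p ! 0) (p ! 1) (p ! 4) (p ! 5))"

text \<open>It identifies the contributions of the ordered root pairs (x, y) and (y, x), each
  feature being paired with another one for the same roots.\<close>

lemma root_term_swap_roots:
  "root_term xy ya xa yb xb yc xc yd xd ab ac ad bc bd cd
   = root_term xy xa ya xb yb xc yc xd yd ab ac ad bc bd cd"
  unfolding root_term_def flag_product_def by (simp only: weighted_inner_swap_roots)

lemma sum_feature_product_roots: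
  assumes sym: "\<And>u v. e u v = e v u"
    and dist: "distinct [a, b, c, d]"
  shows "(\<Sum>ps\<in>distinct_lists 4 {a, b, c, d}. feature_product e (x # y # ps))
       = 8 * root_term (e x y) (e x a) (e y a) (e x b) (e y b) (e x c) (e y c) (e x d) (e y d)
               (e a b) (e a c) (e a d) (e b c) (e b d) (e c d)"
proof -
  let ?f = "vertex_feature e x y"
  let ?w = "weighted_inner weights"
  have feature_sym: "?f z t = ?f t z" for z t
    unfolding vertex_feature_def
    by (subst feature_swap) (simp add: sym[of t z])
  have "feature_product e [x, y, z, t, z', t'] = ?w (?f z t) (?f z' t')" for z t z' t'
    by (simp add: feature_product_def eval_nat_numeral)
  moreover have four: "(4::nat) = Suc (Suc (Suc (Suc 0)))" by simp
  moreover have "b \<noteq> a" "c \<noteq> a" "d \<noteq> a" "c \<noteq> b" "d \<noteq> b" "d \<noteq> c" "a \<noteq> b" "a \<noteq> c" "a \<noteq> d"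
    "b \<noteq> c" "b \<noteq> d" "c \<noteq> d"
    using dist by auto
  ultimately have "(\<Sum>ps\<in>distinct_lists 4 {a, b, c, d}. feature_product e (x # y # ps))
    = ?w (?f a b) (?f c d) + ?w (?f a b) (?f d c) + ?w (?f a c) (?f b d) + ?w (?f a c) (?f d b)
    + ?w (?f a d) (?f b c) + ?w (?f a d) (?f c b) + ?w (?f b a) (?f c d) + ?w (?f b a) (?f d c)
    + ?w (?f b c) (?f a d) + ?w (?f b c) (?f d a) + ?w (?f b d) (?f a c) + ?w (?f b d) (?f c a)
    + ?w (?f c a) (?f b d) + ?w (?f c a) (?f d b) + ?w (?f c b) (?f a d) + ?w (?f c b) (?f d a)
    + ?w (?f c d) (?f a b) + ?w (?f c d) (?f b a) + ?w (?f d a) (?f b c) + ?w (?f d a) (?f c b)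
    + ?w (?f d b) (?f a c) + ?w (?f d b) (?f c a) + ?w (?f d c) (?f a b) + ?w (?f d c) (?f b a)"
    unfolding four by (simp add: sum_distinct_lists_Suc distinct_lists_0 insert_Diff_if add.assoc)
  also have "\<dots> = 8 * (?w (?f a b) (?f c d) + ?w (?f a c) (?f b d) + ?w (?f a d) (?f b c))"
    \<comment> \<open>These instances bring each pair into alphabetical order and put the pair
      containing \<open>a\<close> first, which collapses the 24 terms to three, each occurring 8
      times.\<close>
    by (simp add: feature_sym[of b a] feature_sym[of c a] feature_sym[of d a] feature_sym[of c b]
        feature_sym[of d b] feature_sym[of d c] weighted_inner_commute[of _ "?f b c" "?f a d"]
        weighted_inner_commute[of _ "?f b d" "?f a c"] weighted_inner_commute[of _ "?f c d" "?f a b"])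
  finally show ?thesis
    by (simp add: root_term_def flag_product_def vertex_feature_def)
qed

lemma sum_feature_product:
  assumes sym: "\<And>u v. e u v = e v u"
    and dist: "distinct [v0, v1, v2, v3, v4, v5]"
  shows "(\<Sum>p\<in>distinct_lists 6 {v0, v1, v2, v3, v4, v5}. feature_product e p) =
    16 * root_total (e v0 v1) (e v0 v2) (e v0 v3) (e v0 v4) (e v0 v5) (e v1 v2) (e v1 v3) (e v1 v4) (e v1 v5) (e v2 v3) (e v2 v4) (e v2 v5) (e v3 v4) (e v3 v5) (e v4 v5)"
proof -
  have ne: "v0 \<noteq> v1" "v0 \<noteq> v2" "v0 \<noteq> v3" "v0 \<noteq> v4" "v0 \<noteq> v5"
    "v1 \<noteq> v0" "v1 \<noteq> v2" "v1 \<noteq> v3" "v1 \<noteq> v4" "v1 \<noteq> v5"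
    "v2 \<noteq> v0" "v2 \<noteq> v1" "v2 \<noteq> v3" "v2 \<noteq> v4" "v2 \<noteq> v5"
    "v3 \<noteq> v0" "v3 \<noteq> v1" "v3 \<noteq> v2" "v3 \<noteq> v4" "v3 \<noteq> v5"
    "v4 \<noteq> v0" "v4 \<noteq> v1" "v4 \<noteq> v2" "v4 \<noteq> v3" "v4 \<noteq> v5"
    "v5 \<noteq> v0" "v5 \<noteq> v1" "v5 \<noteq> v2" "v5 \<noteq> v3" "v5 \<noteq> v4"
    using dist by auto
  have outer: "(\<Sum>p\<in>distinct_lists 6 A. feature_product e p)
    = (\<Sum>x\<in>A. \<Sum>y\<in>A - {x}. \<Sum>ps\<in>distinct_lists 4 (A - {x} - {y}). feature_product e (x # y # ps))"
    if "finite A" for A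
    using that by (simp add: sum_distinct_lists_Suc[where n = 5, simplified]
        sum_distinct_lists_Suc[where n = 4, simplified])
  note s = sym[of v1 v0] sym[of v2 v0] sym[of v3 v0] sym[of v4 v0] sym[of v5 v0]
    sym[of v2 v1] sym[of v3 v1] sym[of v4 v1] sym[of v5 v1]
    sym[of v3 v2] sym[of v4 v2] sym[of v5 v2] sym[of v4 v3] sym[of v5 v3] sym[of v5 v4]
  show ?thesis
    by (simp add: ne outer insert_Diff_if sum_feature_product_roots[of e, OF sym] s root_total_def
        \<comment> \<open>One instance per pair of vertices, each turning the term for the roots in
          decreasing order of index into that for increasing order.\<close>
        root_term_swap_roots[of "e v0 v1" "e v1 v2" "e v0 v2" "e v1 v3" "e v0 v3" "e v1 v4" "e v0 v4" "e v1 v5" "e v0 v5" "e v2 v3" "e v2 v4" "e v2 v5" "e v3 v4" "e v3 v5" "e v4 v5"]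
        root_term_swap_roots[of "e v0 v2" "e v1 v2" "e v0 v1" "e v2 v3" "e v0 v3" "e v2 v4" "e v0 v4" "e v2 v5" "e v0 v5" "e v1 v3" "e v1 v4" "e v1 v5" "e v3 v4" "e v3 v5" "e v4 v5"]
        root_term_swap_roots[of "e v0 v3" "e v1 v3" "e v0 v1" "e v2 v3" "e v0 v2" "e v3 v4" "e v0 v4" "e v3 v5" "e v0 v5" "e v1 v2" "e v1 v4" "e v1 v5" "e v2 v4" "e v2 v5" "e v4 v5"]
        root_term_swap_roots[of "e v0 v4" "e v1 v4" "e v0 v1" "e v2 v4" "e v0 v2" "e v3 v4" "e v0 v3" "e v4 v5" "e v0 v5" "e v1 v2" "e v1 v3" "e v1 v5" "e v2 v3" "e v2 v5" "e v3 v5"]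
        root_term_swap_roots[of "e v0 v5" "e v1 v5" "e v0 v1" "e v2 v5" "e v0 v2" "e v3 v5" "e v0 v3" "e v4 v5" "e v0 v4" "e v1 v2" "e v1 v3" "e v1 v4" "e v2 v3" "e v2 v4" "e v3 v4"]
        root_term_swap_roots[of "e v1 v2" "e v0 v2" "e v0 v1" "e v2 v3" "e v1 v3" "e v2 v4" "e v1 v4" "e v2 v5" "e v1 v5" "e v0 v3" "e v0 v4" "e v0 v5" "e v3 v4" "e v3 v5" "e v4 v5"]
        root_term_swap_roots[of "e v1 v3" "e v0 v3" "e v0 v1" "e v2 v3" "e v1 v2" "e v3 v4" "e v1 v4" "e v3 v5" "e v1 v5" "e v0 v2" "e v0 v4" "e v0 v5" "e v2 v4" "e v2 v5" "e v4 v5"]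
        root_term_swap_roots[of "e v1 v4" "e v0 v4" "e v0 v1" "e v2 v4" "e v1 v2" "e v3 v4" "e v1 v3" "e v4 v5" "e v1 v5" "e v0 v2" "e v0 v3" "e v0 v5" "e v2 v3" "e v2 v5" "e v3 v5"]
        root_term_swap_roots[of "e v1 v5" "e v0 v5" "e v0 v1" "e v2 v5" "e v1 v2" "e v3 v5" "e v1 v3" "e v4 v5" "e v1 v4" "e v0 v2" "e v0 v3" "e v0 v4" "e v2 v3" "e v2 v4" "e v3 v4"]
        root_term_swap_roots[of "e v2 v3" "e v0 v3" "e v0 v2" "e v1 v3" "e v1 v2" "e v3 v4" "e v2 v4" "e v3 v5" "e v2 v5" "e v0 v1" "e v0 v4" "e v0 v5" "e v1 v4" "e v1 v5" "e v4 v5"]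
        root_term_swap_roots[of "e v2 v4" "e v0 v4" "e v0 v2" "e v1 v4" "e v1 v2" "e v3 v4" "e v2 v3" "e v4 v5" "e v2 v5" "e v0 v1" "e v0 v3" "e v0 v5" "e v1 v3" "e v1 v5" "e v3 v5"]
        root_term_swap_roots[of "e v2 v5" "e v0 v5" "e v0 v2" "e v1 v5" "e v1 v2" "e v3 v5" "e v2 v3" "e v4 v5" "e v2 v4" "e v0 v1" "e v0 v3" "e v0 v4" "e v1 v3" "e v1 v4" "e v3 v4"]
        root_term_swap_roots[of "e v3 v4" "e v0 v4" "e v0 v3" "e v1 v4" "e v1 v3" "e v2 v4" "e v2 v3" "e v4 v5" "e v3 v5" "e v0 v1" "e v0 v2" "e v0 v5" "e v1 v2" "e v1 v5" "e v2 v5"]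
        root_term_swap_roots[of "e v3 v5" "e v0 v5" "e v0 v3" "e v1 v5" "e v1 v3" "e v2 v5" "e v2 v3" "e v4 v5" "e v3 v4" "e v0 v1" "e v0 v2" "e v0 v4" "e v1 v2" "e v1 v4" "e v2 v4"]
        root_term_swap_roots[of "e v4 v5" "e v0 v5" "e v0 v4" "e v1 v5" "e v1 v4" "e v2 v5" "e v2 v4" "e v3 v5" "e v3 v4" "e v0 v1" "e v0 v2" "e v0 v3" "e v1 v2" "e v1 v3" "e v2 v3"])
qed

lemma sum_of_bool_three_edges:
  fixes F :: "'a graph"
  assumes F: "is_graph F" and "verts F = {v0, v1, v2, v3, v4, v5}" and dist: "distinct [v0, v1, v2, v3, v4, v5]"
  shows "real (card {S \<in> ksubsets 4 (verts F). card (edges (induced F S)) = 3})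
       = of_int (three_total (adj F v0 v1) (adj F v0 v2) (adj F v0 v3) (adj F v0 v4) (adj F v0 v5) (adj F v1 v2) (adj F v1 v3) (adj F v1 v4) (adj F v1 v5) (adj F v2 v3) (adj F v2 v4) (adj F v2 v5) (adj F v3 v4) (adj F v3 v5) (adj F v4 v5))"
proof -
  \<comment> \<open>As a sum of indicators over two-subsets, the number of edges can be unfolded by
    the recursion for \<open>ksubsets\<close>.\<close>
  have edges2: "card (edges (induced F S)) = (\<Sum>T\<in>ksubsets 2 S. of_bool (T \<in> edges F))"
    if "finite S" for S
  proof -
    have "edges (induced F S) = ksubsets 2 S \<inter> edges F"
      using F by (auto simp: induced_def ksubsets_def is_graph_def)
    then show ?thesis using that by (simp add: finite_ksubsets Int_def)
  qed
  have two: "(2::nat) = Suc (Suc 0)" and four: "(4::nat) = Suc (Suc (Suc (Suc 0)))" by simp_all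
  have sum4: "(\<Sum>S\<in>ksubsets 4 {v0, v1, v2, v3, v4, v5}. g S) =
      g {v0, v1, v2, v3} +
      g {v0, v1, v2, v4} +
      g {v0, v1, v2, v5} +
      g {v0, v1, v3, v4} +
      g {v0, v1, v3, v5} +
      g {v0, v1, v4, v5} +
      g {v0, v2, v3, v4} +
      g {v0, v2, v3, v5} +
      g {v0, v2, v4, v5} +
      g {v0, v3, v4, v5} +
      g {v1, v2, v3, v4} +
      g {v1, v2, v3, v5} +
      g {v1, v2, v4, v5} +
      g {v1, v3, v4, v5} +
      g {v2, v3, v4, v5}" for g :: "'a set \<Rightarrow> int"
    unfolding four using dist by (simp add: sum_ksubsets_insert ksubsets_0 ksubsets_empty add.assoc)
  have three: "of_bool (card (edges (induced F {a, b, c, d})) = 3)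
      = three (adj F a b) (adj F a c) (adj F a d) (adj F b c) (adj F b d) (adj F c d)"
    if "distinct [a, b, c, d]" for a b c d
    using that unfolding three_def
    by (simp add: edges2 two sum_ksubsets_insert ksubsets_0 ksubsets_empty insert_commute ac_simps)
  have d: "distinct [v0, v1, v2, v3]" "distinct [v0, v1, v2, v4]" "distinct [v0, v1, v2, v5]"
    "distinct [v0, v1, v3, v4]" "distinct [v0, v1, v3, v5]" "distinct [v0, v1, v4, v5]"
    "distinct [v0, v2, v3, v4]" "distinct [v0, v2, v3, v5]" "distinct [v0, v2, v4, v5]"
    "distinct [v0, v3, v4, v5]" "distinct [v1, v2, v3, v4]" "distinct [v1, v2, v3, v5]"
    "distinct [v1, v2, v4, v5]" "distinct [v1, v3, v4, v5]" "distinct [v2, v3, v4, v5]"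
    using dist by simp_all
  have "int (card {S \<in> ksubsets 4 (verts F). card (edges (induced F S)) = 3})
      = (\<Sum>S\<in>ksubsets 4 (verts F). of_bool (card (edges (induced F S)) = 3))"
    using F by (simp add: finite_ksubsets is_graph_def Int_def)
  also have "\<dots> = three_total (adj F v0 v1) (adj F v0 v2) (adj F v0 v3) (adj F v0 v4) (adj F v0 v5) (adj F v1 v2) (adj F v1 v3) (adj F v1 v4) (adj F v1 v5) (adj F v2 v3) (adj F v2 v4) (adj F v2 v5) (adj F v3 v4) (adj F v3 v5) (adj F v4 v5)"
    unfolding assms(2) sum4 three_total_def d[THEN three] ..
  finally have "real_of_int (int (card {S \<in> ksubsets 4 (verts F). card (edges (induced F S)) = 3}))
      = real_of_int (three_total (adj F v0 v1) (adj F v0 v2) (adj F v0 v3) (adj F v0 v4) (adj F v0 v5) (adj F v1 v2) (adj F v1 v3) (adj F v1 v4) (adj F v1 v5) (adj F v2 v3) (adj F v2 v4) (adj F v2 v5) (adj F v3 v4) (adj F v3 v5) (adj F v4 v5))"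
    by (rule arg_cong)
  then show ?thesis by (simp only: of_int_of_nat_eq)
qed

lemma sorted_by_degree:
  fixes deg :: "'a \<Rightarrow> nat"
  assumes "finite V" "card V = 6"
  obtains v0 v1 v2 v3 v4 v5 where "V = {v0, v1, v2, v3, v4, v5}" "distinct [v0, v1, v2, v3, v4, v5]"
    "deg v1 \<le> deg v0" "deg v2 \<le> deg v1" "deg v3 \<le> deg v2" "deg v4 \<le> deg v3" "deg v5 \<le> deg v4"
proof -
  obtain us where us: "set us = V" "distinct us"
    using finite_distinct_list[OF assms(1)] by blast
  \<comment> \<open>\<open>sort_key\<close> sorts in ascending order, so the negated degree gives
    nonincreasing degrees.\<close>
  define vs where "vs = sort_key (\<lambda>v. - int (deg v)) us"
  have vs: "set vs = V" "distinct vs" "sorted (map (\<lambda>v. - int (deg v)) vs)"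
    by (simp_all add: vs_def us)
  then have "length vs = 6" using assms(2) distinct_card by metis
  then obtain v0 v1 v2 v3 v4 v5 where "vs = [v0, v1, v2, v3, v4, v5]"
    by (auto simp: length_Suc_conv eval_nat_numeral)
  then show ?thesis using that vs by auto
qed

theorem six_vertex_inequality:
  fixes F :: "'a graph"
  assumes F: "is_graph F" and card: "card (verts F) = 6"
  shows "(\<Sum>p\<in>distinct_lists 6 (verts F). real_of_int (feature_product (adj F) p)) / 161280
       \<le> 1 / 2 - edge_density 4 3 F"
proof -
  have fin: "finite (verts F)" using F by (simp add: is_graph_def)
  define deg :: "'a \<Rightarrow> nat" where "deg v = (\<Sum>u\<in>verts F - {v}. of_bool (adj F v u))" for v
  obtain v0 v1 v2 v3 v4 v5 where V: "verts F = {v0, v1, v2, v3, v4, v5}" and dist: "distinct [v0, v1, v2, v3, v4, v5]"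
    and deg: "deg v1 \<le> deg v0" "deg v2 \<le> deg v1" "deg v3 \<le> deg v2" "deg v4 \<le> deg v3" "deg v5 \<le> deg v4"
    using sorted_by_degree[OF fin card] by metis
  have sym: "adj F u v = adj F v u" for u v by (simp add: insert_commute)
  note s = sym[of v1 v0] sym[of v2 v0] sym[of v3 v0] sym[of v4 v0] sym[of v5 v0]
    sym[of v2 v1] sym[of v3 v1] sym[of v4 v1] sym[of v5 v1]
    sym[of v3 v2] sym[of v4 v2] sym[of v5 v2] sym[of v4 v3] sym[of v5 v3] sym[of v5 v4]
  have ne: "v0 \<noteq> v1" "v0 \<noteq> v2" "v0 \<noteq> v3" "v0 \<noteq> v4" "v0 \<noteq> v5"
    "v1 \<noteq> v0" "v1 \<noteq> v2" "v1 \<noteq> v3" "v1 \<noteq> v4" "v1 \<noteq> v5"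
    "v2 \<noteq> v0" "v2 \<noteq> v1" "v2 \<noteq> v3" "v2 \<noteq> v4" "v2 \<noteq> v5"
    "v3 \<noteq> v0" "v3 \<noteq> v1" "v3 \<noteq> v2" "v3 \<noteq> v4" "v3 \<noteq> v5"
    "v4 \<noteq> v0" "v4 \<noteq> v1" "v4 \<noteq> v2" "v4 \<noteq> v3" "v4 \<noteq> v5"
    "v5 \<noteq> v0" "v5 \<noteq> v1" "v5 \<noteq> v2" "v5 \<noteq> v3" "v5 \<noteq> v4"
    using dist by auto
  have degs: "deg v0 = of_bool (adj F v0 v1) + of_bool (adj F v0 v2) + of_bool (adj F v0 v3) + of_bool (adj F v0 v4) + of_bool (adj F v0 v5)"
    "deg v1 = of_bool (adj F v0 v1) + of_bool (adj F v1 v2) + of_bool (adj F v1 v3) + of_bool (adj F v1 v4) + of_bool (adj F v1 v5)"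
    "deg v2 = of_bool (adj F v0 v2) + of_bool (adj F v1 v2) + of_bool (adj F v2 v3) + of_bool (adj F v2 v4) + of_bool (adj F v2 v5)"
    "deg v3 = of_bool (adj F v0 v3) + of_bool (adj F v1 v3) + of_bool (adj F v2 v3) + of_bool (adj F v3 v4) + of_bool (adj F v3 v5)"
    "deg v4 = of_bool (adj F v0 v4) + of_bool (adj F v1 v4) + of_bool (adj F v2 v4) + of_bool (adj F v3 v4) + of_bool (adj F v4 v5)"
    "deg v5 = of_bool (adj F v0 v5) + of_bool (adj F v1 v5) + of_bool (adj F v2 v5) + of_bool (adj F v3 v5) + of_bool (adj F v4 v5)"
    using ne by (simp_all add: deg_def V insert_Diff_if s)
  let ?cs = "[adj F v0 v1, adj F v0 v2, adj F v0 v3, adj F v0 v4, adj F v0 v5, adj F v1 v2, adj F v1 v3, adj F v1 v4, adj F v1 v5, adj F v2 v3, adj F v2 v4, adj F v2 v5, adj F v3 v4, adj F v3 v5, adj F v4 v5]"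
  have "degrees_ok ([] @ take k ?cs)" for k
  \<comment> \<open>Only the prefixes of lengths 9, 12 and 14 carry a condition below 15, and from
    15 on \<open>take\<close> returns the whole code.\<close>
  proof (cases "k < 15")
    case True
    then have "k \<in> {0, 1, 2, 3, 4, 5, 6, 7, 8, 9, 10, 11, 12, 13, 14}"
      unfolding insert_iff empty_iff by presburger
    then show ?thesis using deg unfolding degs by auto
  next
    case False
    then show ?thesis using deg unfolding degs by simp
  qed
  then have "code_ok ([] @ ?cs)"
    by (intro search_sound[OF search_succeeds]) simp_all
  then have "root_total (adj F v0 v1) (adj F v0 v2) (adj F v0 v3) (adj F v0 v4) (adj F v0 v5) (adj F v1 v2) (adj F v1 v3) (adj F v1 v4) (adj F v1 v5) (adj F v2 v3) (adj F v2 v4) (adj F v2 v5) (adj F v3 v4) (adj F v3 v5) (adj F v4 v5) + 672 * three_total (adj F v0 v1) (adj F v0 v2) (adj F v0 v3) (adj F v0 v4) (adj F v0 v5) (adj F v1 v2) (adj F v1 v3) (adj F v1 v4) (adj F v1 v5) (adj F v2 v3) (adj F v2 v4) (adj F v2 v5) (adj F v3 v4) (adj F v3 v5) (adj F v4 v5) \<le> 5040"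
    by simp
  then have "16 * root_total (adj F v0 v1) (adj F v0 v2) (adj F v0 v3) (adj F v0 v4) (adj F v0 v5) (adj F v1 v2) (adj F v1 v3) (adj F v1 v4) (adj F v1 v5) (adj F v2 v3) (adj F v2 v4) (adj F v2 v5) (adj F v3 v4) (adj F v3 v5) (adj F v4 v5) + 10752 * three_total (adj F v0 v1) (adj F v0 v2) (adj F v0 v3) (adj F v0 v4) (adj F v0 v5) (adj F v1 v2) (adj F v1 v3) (adj F v1 v4) (adj F v1 v5) (adj F v2 v3) (adj F v2 v4) (adj F v2 v5) (adj F v3 v4) (adj F v3 v5) (adj F v4 v5) \<le> 80640"
    by linarith
  then have "(\<Sum>p\<in>distinct_lists 6 (verts F). feature_product (adj F) p)
      + 10752 * three_total (adj F v0 v1) (adj F v0 v2) (adj F v0 v3) (adj F v0 v4) (adj F v0 v5) (adj F v1 v2) (adj F v1 v3) (adj F v1 v4) (adj F v1 v5) (adj F v2 v3) (adj F v2 v4) (adj F v2 v5) (adj F v3 v4) (adj F v3 v5) (adj F v4 v5) \<le> 80640"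
    using sum_feature_product[of "adj F", OF sym dist] by (simp only: V)
  then have "(\<Sum>p\<in>distinct_lists 6 (verts F). real_of_int (feature_product (adj F) p))
      + 10752 * real_of_int (three_total (adj F v0 v1) (adj F v0 v2) (adj F v0 v3) (adj F v0 v4) (adj F v0 v5) (adj F v1 v2) (adj F v1 v3) (adj F v1 v4) (adj F v1 v5) (adj F v2 v3) (adj F v2 v4) (adj F v2 v5) (adj F v3 v4) (adj F v3 v5) (adj F v4 v5)) \<le> 80640"
    unfolding of_int_sum[symmetric] by linarith
  moreover have "edge_density 4 3 F = real_of_int (three_total (adj F v0 v1) (adj F v0 v2) (adj F v0 v3) (adj F v0 v4) (adj F v0 v5) (adj F v1 v2) (adj F v1 v3) (adj F v1 v4) (adj F v1 v5) (adj F v2 v3) (adj F v2 v4) (adj F v2 v5) (adj F v3 v4) (adj F v3 v5) (adj F v4 v5)) / 15"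
  proof -
    have "(6::nat) choose 4 = 15" by (simp add: eval_nat_numeral)
    then show ?thesis
      using sum_of_bool_three_edges[OF F V dist] card
      by (simp add: edge_density_def ksubsets_def conj_assoc)
  qed
  ultimately show ?thesis by (simp add: field_simps)
qed

section \<open>The certificate\<close>

lemma sum_distinct_lists_map:
  fixes g :: "'b list \<Rightarrow> 'c::comm_monoid_add"
  assumes "bij_betw \<phi> A B"
  shows "(\<Sum>ys\<in>distinct_lists n B. g ys) = (\<Sum>xs\<in>distinct_lists n A. g (map \<phi> xs))"
proof -
  have inj: "inj_on \<phi> A" and img: "\<phi> ` A = B" using assms by (auto simp: bij_betw_def)
  let ?\<psi> = "inv_into A \<phi>"
  have \<psi>: "?\<psi> y \<in> A" "\<phi> (?\<psi> y) = y" if "y \<in> B" for y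
    using that img by (auto simp: inv_into_into f_inv_into_f)
  have inj': "inj_on ?\<psi> B" using \<psi>(2) by (rule inj_on_inverseI)
  show ?thesis
  proof (rule sum.reindex_bij_witness[where i = "map \<phi>" and j = "map ?\<psi>"])
    fix ys assume "ys \<in> distinct_lists n B"
    then have ys: "length ys = n" "distinct ys" "set ys \<subseteq> B" by (simp_all add: distinct_lists_def)
    show "map \<phi> (map ?\<psi> ys) = ys"
      using ys(3) \<psi>(2) by (simp add: map_idI subset_iff)
    then show "g (map \<phi> (map ?\<psi> ys)) = g ys" by simp
    show "map ?\<psi> ys \<in> distinct_lists n A"
      using ys \<psi>(1) inj_on_subset[OF inj' ys(3)]
      by (auto simp: distinct_lists_def distinct_map)
  next
    fix xs assume "xs \<in> distinct_lists n A"
    then have xs: "length xs = n" "distinct xs" "set xs \<subseteq> A" by (simp_all add: distinct_lists_def)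
    show "map ?\<psi> (map \<phi> xs) = xs"
      using xs(3) inj by (simp add: map_idI subset_iff)
    show "map \<phi> xs \<in> distinct_lists n B"
      using xs img inj_on_subset[OF inj xs(3)] by (auto simp: distinct_lists_def distinct_map)
  qed
qed

lemma nth_distinct_lists: "xs \<in> distinct_lists n A \<Longrightarrow> i < n \<Longrightarrow> xs ! i \<in> A"
  by (auto simp: distinct_lists_def dest: nth_mem)

lemma vertex_feature_cong:
  assumes "\<And>u v. u \<in> A \<Longrightarrow> v \<in> A \<Longrightarrow> e u v = e' (\<phi> u) (\<phi> v)" "x \<in> A" "y \<in> A" "z \<in> A" "t \<in> A"
  shows "vertex_feature e x y z t = vertex_feature e' (\<phi> x) (\<phi> y) (\<phi> z) (\<phi> t)"
  using assms by (simp add: vertex_feature_def)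

lemma feature_product_cong:
  assumes "\<And>u v. u \<in> A \<Longrightarrow> v \<in> A \<Longrightarrow> e u v = e' (\<phi> u) (\<phi> v)" "p \<in> distinct_lists 6 A"
  shows "feature_product e p = feature_product e' (map \<phi> p)"
proof -
  have "p ! i \<in> A \<and> map \<phi> p ! i = \<phi> (p ! i)" if "i < 6" for i
    using assms(2) that nth_distinct_lists[OF assms(2) that] by (simp add: distinct_lists_def)
  then show ?thesis
    using assms(1) by (simp add: feature_product_def vertex_feature_cong[where e' = e' and \<phi> = \<phi> and A = A])
qed

text \<open>There are \<open>720\<close> orderings of six vertices, and \<open>161280 = 720 * 224\<close>; with the integral weights
  above, an average of \<open>224 * (1/2 - \<lambda>)\<close> is what the certificate allows.\<close>

definition feature_total :: "'a graph \<Rightarrow> real" where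
  "feature_total G =
    (\<Sum>p\<in>distinct_lists 6 (verts G). real_of_int (feature_product (adj G) p)) / 161280"

text \<open>Intended for four-vertex flags, where the sum runs over the two orderings of the
  unlabelled vertices. It is an isomorphism invariant, and adding up these values over the
  extensions of fixed roots yields a sum over all ordered pairs.\<close>

definition flag_feature :: "nat \<Rightarrow> 'a flag \<Rightarrow> real" where
  "flag_feature k F =
    (\<Sum>us\<in>distinct_lists 2 (verts (fst F) - snd F ` {..<2}).
       real_of_int (vertex_feature (adj (fst F)) (snd F 0) (snd F 1) (us ! 0) (us ! 1) ! k))"

lemma feature_total_iso:
  assumes "isomorphic F H"
  shows "feature_total F = feature_total H"
proof -
  obtain \<phi> where "is_iso \<phi> F H" using assms by (auto simp: isomorphic_def)
  then have bij: "bij_betw \<phi> (verts F) (verts H)"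
    and adj: "\<And>u v. u \<in> verts F \<Longrightarrow> v \<in> verts F \<Longrightarrow> adj F u v = adj H (\<phi> u) (\<phi> v)"
    by (auto simp: is_iso_def)
  show ?thesis
    unfolding feature_total_def sum_distinct_lists_map[OF bij]
    by (intro arg_cong2[where f = "(/)"] sum.cong arg_cong[where f = real_of_int]
        feature_product_cong[where A = "verts F"] adj refl)
qed

lemma flag_feature_iso:
  assumes "is_flag 2 F" "flag_isomorphic 2 F H"
  shows "flag_feature k F = flag_feature k H"
proof -
  obtain \<phi> where "is_iso \<phi> (fst F) (fst H)" and root: "\<And>i. i < 2 \<Longrightarrow> \<phi> (snd F i) = snd H i"
    using assms(2) by (auto simp: flag_isomorphic_def)
  then have bij: "bij_betw \<phi> (verts (fst F)) (verts (fst H))"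
    and adj: "\<And>u v. u \<in> verts (fst F) \<Longrightarrow> v \<in> verts (fst F) \<Longrightarrow> adj (fst F) u v = adj (fst H) (\<phi> u) (\<phi> v)"
    by (auto simp: is_iso_def)
  have sub: "snd F ` {..<2} \<subseteq> verts (fst F)" using assms(1) by (simp add: is_flag_def)
  have "\<phi> ` snd F ` {..<2} = snd H ` {..<2}" using root by (force simp: image_image)
  then have "\<phi> ` (verts (fst F) - snd F ` {..<2}) = verts (fst H) - snd H ` {..<2}"
    using bij sub by (simp add: bij_betw_def inj_on_image_set_diff[of \<phi> "verts (fst F)"])
  then have bij': "bij_betw \<phi> (verts (fst F) - snd F ` {..<2}) (verts (fst H) - snd H ` {..<2})"
    using bij by (auto simp: bij_betw_def intro: inj_on_subset)
  have roots: "snd F 0 \<in> verts (fst F)" "snd F 1 \<in> verts (fst F)" using sub by auto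
  show ?thesis
    unfolding flag_feature_def sum_distinct_lists_map[OF bij']
  proof (rule sum.cong[OF refl])
    fix us assume us: "us \<in> distinct_lists 2 (verts (fst F) - snd F ` {..<2})"
    then have "us ! 0 \<in> verts (fst F)" "us ! 1 \<in> verts (fst F)" "length us = 2"
      using nth_distinct_lists[OF us, of 0] nth_distinct_lists[OF us, of 1]
      by (simp_all add: distinct_lists_def)
    then show "real_of_int (vertex_feature (adj (fst F)) (snd F 0) (snd F 1) (us ! 0) (us ! 1) ! k)
       = real_of_int (vertex_feature (adj (fst H)) (snd H 0) (snd H 1) (map \<phi> us ! 0) (map \<phi> us ! 1) ! k)"
      using vertex_feature_cong[where e = "adj (fst F)" and e' = "adj (fst H)" and \<phi> = \<phi>
          and z = "us ! 0" and t = "us ! 1", OF adj roots] root[of 0] root[of 1]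
      by simp
  qed
qed

lemma edge_density_iso:
  assumes G: "is_graph G" and H: "is_graph H" and "isomorphic G H"
  shows "edge_density k l G = edge_density k l H"
proof -
  obtain \<phi> where "is_iso \<phi> G H" using assms by (auto simp: isomorphic_def)
  then have inj: "inj_on \<phi> (verts G)" and img: "\<phi> ` verts G = verts H"
    and adj: "\<And>u v. u \<in> verts G \<Longrightarrow> v \<in> verts G \<Longrightarrow> adj G u v = adj H (\<phi> u) (\<phi> v)"
    by (auto simp: is_iso_def bij_betw_def)
  have edge_iff: "e \<in> edges G \<longleftrightarrow> \<phi> ` e \<in> edges H" if e: "e \<subseteq> verts G" for e
  \<comment> \<open>\<open>is_iso\<close> speaks only of sets of the form {x, y}. A set whose size
    is not 2 is an edge of neither graph, and the injective map preserves sizes.\<close>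
  proof (cases "card e = 2")
    case True
    then obtain u v where "e = {u, v}" by (auto simp: card_2_iff)
    then show ?thesis using adj e by simp
  next
    case False
    moreover have "card (\<phi> ` e) = card e" using inj e by (meson card_image inj_on_subset)
    ultimately show ?thesis using G H by (auto simp: is_graph_def)
  qed
  have induced: "card (edges (induced H (\<phi> ` S))) = card (edges (induced G S))"
    if S: "S \<subseteq> verts G" for S
  proof -
    have "edges (induced H (\<phi> ` S)) = (`) \<phi> ` edges (induced G S)"
    proof (intro equalityI subsetI)
      fix d assume "d \<in> edges (induced H (\<phi> ` S))"
      then obtain e where "e \<subseteq> S" "d = \<phi> ` e" "d \<in> edges H"
        by (auto simp: induced_def subset_image_iff)
      then show "d \<in> (`) \<phi> ` edges (induced G S)"
        using edge_iff S by (auto simp: induced_def)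
    next
      fix d assume "d \<in> (`) \<phi> ` edges (induced G S)"
      then show "d \<in> edges (induced H (\<phi> ` S))"
        using edge_iff S by (auto simp: induced_def)
    qed
    moreover have "inj_on ((`) \<phi>) (edges (induced G S))"
      using inj_on_image_Pow[OF inj] by (rule inj_on_subset) (use S in \<open>auto simp: induced_def\<close>)
    ultimately show ?thesis by (simp add: card_image)
  qed
  have "{S. S \<subseteq> verts H \<and> card S = k \<and> card (edges (induced H S)) = l}
      = (`) \<phi> ` {S. S \<subseteq> verts G \<and> card S = k \<and> card (edges (induced G S)) = l}"
  proof (intro equalityI subsetI)
    fix T assume T: "T \<in> {S. S \<subseteq> verts H \<and> card S = k \<and> card (edges (induced H S)) = l}"
    then have "T \<subseteq> \<phi> ` verts G" using img by simp
    then obtain S where S: "S \<subseteq> verts G" "T = \<phi> ` S" by (auto simp: subset_image_iff)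
    moreover have "card T = card S" using S inj by (meson card_image inj_on_subset)
    ultimately show "T \<in> (`) \<phi> ` {S. S \<subseteq> verts G \<and> card S = k \<and> card (edges (induced G S)) = l}"
      using T induced by auto
  next
    fix T assume "T \<in> (`) \<phi> ` {S. S \<subseteq> verts G \<and> card S = k \<and> card (edges (induced G S)) = l}"
    then obtain S where S: "S \<subseteq> verts G" "T = \<phi> ` S" "card S = k" "card (edges (induced G S)) = l"
      by auto
    moreover have "card T = card S" using S inj by (meson card_image inj_on_subset)
    moreover have "T \<subseteq> verts H" using S img by auto
    ultimately show "T \<in> {S. S \<subseteq> verts H \<and> card S = k \<and> card (edges (induced H S)) = l}"
      using induced by simp
  qed
  moreover have "inj_on ((`) \<phi>) {S. S \<subseteq> verts G \<and> card S = k \<and> card (edges (induced G S)) = l}"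
    using inj_on_image_Pow[OF inj] by (rule inj_on_subset) auto
  ultimately show ?thesis
    using inj img card_image[OF inj] by (simp add: edge_density_def card_image)
qed

section \<open>The matrix and its quadratic form\<close>

lemma length_vertex_feature: "length (vertex_feature e x y z t) = 5"
  by (simp add: vertex_feature_def feature_def feature_of_def)

lemma weighted_inner_weights:
  assumes "length xs = 5" "length ys = 5"
  shows "real_of_int (weighted_inner weights xs ys)
       = (\<Sum>k<5. real_of_int (weights ! k) * real_of_int (xs ! k) * real_of_int (ys ! k))"
proof -
  obtain x0 x1 x2 x3 x4 y0 y1 y2 y3 y4 where "xs = [x0, x1, x2, x3, x4]" "ys = [y0, y1, y2, y3, y4]"
    using assms by (auto simp: length_Suc_conv eval_nat_numeral)
  then show ?thesis by (simp add: weights_def eval_nat_numeral lessThan_Suc)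
qed

text \<open>A feature is determined by five Booleans, so the inner product takes finitely many
  values, whatever the graph and the vertices are.\<close>

lemma weighted_inner_feature_bounded:
  obtains C where "C \<ge> 0"
    "\<And>e x y z t e' x' y' z' t'. \<bar>real_of_int (weighted_inner weights (vertex_feature e x y z t)
        (vertex_feature e' x' y' z' t'))\<bar> \<le> C"
proof -
  let ?g = "\<lambda>(p, q, r, s, w, p', q', r', s', w').
    \<bar>real_of_int (weighted_inner weights (feature p q r s w) (feature p' q' r' s' w'))\<bar>"
  have fin: "finite (range ?g)" by simp
  have "\<bar>real_of_int (weighted_inner weights (feature p q r s w) (feature p' q' r' s' w'))\<bar>
      \<le> Max (range ?g)" for p q r s w p' q' r' s' w'
    by (rule Max_ge[OF fin]) (rule range_eqI[of _ _ "(p, q, r, s, w, p', q', r', s', w')"], simp)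
  then show ?thesis
    using that[of "Max (range ?g)"] unfolding vertex_feature_def by (meson abs_ge_zero order_trans)
qed

text \<open>A nonnegative combination of five rank-one matrices, written through invariants of the
  flags because its index set consists of chosen representatives. One formula serves the edge and
  the non-edge type, since the features are relative to the root pair; the scale is that of
  \<open>feature_total\<close>.\<close>

definition certificate_matrix :: "nat graph \<Rightarrow> nat flag \<Rightarrow> nat flag \<Rightarrow> real" where
  "certificate_matrix \<tau> F H =
    (if card (verts \<tau>) = 2
     then \<Sum>k<5. real_of_int (weights ! k) / 161280 * flag_feature k F * flag_feature k H
     else 0)"

text \<open>The form is a weighted sum of squares of linear functionals. This gives positive
  semidefiniteness and also evaluates the form on the vector of flag counts.\<close>

lemma quadratic_form_rank_one_sum:
  fixes v :: "'i \<Rightarrow> real"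
  shows "(\<Sum>i\<in>I. \<Sum>j\<in>I. v i * (\<Sum>k\<in>L. w k * g k i * g k j) * v j)
       = (\<Sum>k\<in>L. w k * (\<Sum>i\<in>I. g k i * v i)\<^sup>2)"
proof -
  have "(\<Sum>i\<in>I. \<Sum>j\<in>I. v i * (\<Sum>k\<in>L. w k * g k i * g k j) * v j)
      = (\<Sum>i\<in>I. \<Sum>j\<in>I. \<Sum>k\<in>L. w k * ((g k i * v i) * (g k j * v j)))"
    by (simp add: sum_distrib_left sum_distrib_right mult_ac)
  also have "\<dots> = (\<Sum>k\<in>L. \<Sum>i\<in>I. \<Sum>j\<in>I. w k * ((g k i * v i) * (g k j * v j)))"
    by (subst sum.swap[of _ L], subst sum.swap[of _ L]) (simp add: sum.swap[of _ L I])
  also have "\<dots> = (\<Sum>k\<in>L. w k * (\<Sum>i\<in>I. g k i * v i)\<^sup>2)"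
    unfolding power2_eq_square sum_product unfolding sum_distrib_left ..
  finally show ?thesis .
qed

lemma weights_nonneg: "k < 5 \<Longrightarrow> 0 \<le> weights ! k"
  by (auto simp: weights_def eval_nat_numeral less_Suc_eq)

lemma certificate_matrix_psd: "psd_on I (certificate_matrix \<tau>)"
proof -
  have "0 \<le> (\<Sum>i\<in>I. \<Sum>j\<in>I. v i * certificate_matrix \<tau> i j * v j)" for v
  proof (cases "card (verts \<tau>) = 2")
    case True
    have "0 \<le> (\<Sum>k<5. real_of_int (weights ! k) / 161280 * (\<Sum>i\<in>I. flag_feature k i * v i)\<^sup>2)"
      using weights_nonneg by (intro sum_nonneg mult_nonneg_nonneg) auto
    then show ?thesis
      unfolding certificate_matrix_def if_P[OF True] quadratic_form_rank_one_sum .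
  qed (simp add: certificate_matrix_def)
  moreover have "certificate_matrix \<tau> i j = certificate_matrix \<tau> j i" for i j
    by (simp add: certificate_matrix_def mult_ac)
  ultimately show ?thesis by (simp add: psd_on_def)
qed

text \<open>The value of the k-th linear functional on the flag counts. Every two-set outside the
  roots induces one four-vertex flag and contributes its two orderings; together they are all
  ordered pairs of further vertices.\<close>

lemma sum_flag_feature_count:
  fixes G :: "nat graph"
  assumes G: "is_graph G" and f: "f \<in> {..<2} \<rightarrow>\<^sub>E verts G" "inj_on f {..<2}"
  shows "(\<Sum>F\<in>unlabelled_flags (root_type 2 G f) 4. flag_feature k F * real (flag_count 2 F (G, f)))
       = (\<Sum>us\<in>distinct_lists 2 (verts G - {f 0, f 1}).
            real_of_int (vertex_feature (adj G) (f 0) (f 1) (us ! 0) (us ! 1) ! k))"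
proof -
  have R: "f ` {..<2} = {f 0, f 1}" by (auto simp: lessThan_Suc numeral_2_eq_2)
  have fin: "finite (verts G - {f 0, f 1})" using G by (simp add: is_graph_def)
  have "(\<Sum>F\<in>unlabelled_flags (root_type 2 G f) 4. flag_feature k F * real (flag_count 2 F (G, f)))
      = (\<Sum>X\<in>ksubsets (4 - 2) (verts G - f ` {..<2}). flag_feature k (induced G (X \<union> f ` {..<2}), f))"
    by (rule sum_flag_count[OF G f]) (simp_all add: flag_feature_iso)
  also have "\<dots> = (\<Sum>X\<in>ksubsets 2 (verts G - {f 0, f 1}). flag_feature k (induced G (X \<union> {f 0, f 1}), f))"
    by (simp add: R)
  also have "\<dots> = (\<Sum>X\<in>ksubsets 2 (verts G - {f 0, f 1}). \<Sum>us\<in>distinct_lists 2 X.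
            real_of_int (vertex_feature (adj G) (f 0) (f 1) (us ! 0) (us ! 1) ! k))"
  proof (rule sum.cong[OF refl])
    fix X assume "X \<in> ksubsets 2 (verts G - {f 0, f 1})"
    then have X: "X \<inter> {f 0, f 1} = {}" by (auto simp: ksubsets_def)
    let ?A = "X \<union> {f 0, f 1}"
    have "verts (induced G ?A) - f ` {..<2} = X" using X by (auto simp: induced_def R)
    moreover have "vertex_feature (adj (induced G ?A)) (f 0) (f 1) (us ! 0) (us ! 1)
        = vertex_feature (adj G) (f 0) (f 1) (us ! 0) (us ! 1)" if us: "us \<in> distinct_lists 2 X" for us
      using nth_distinct_lists[OF us, of 0] nth_distinct_lists[OF us, of 1]
      by (simp add: vertex_feature_def induced_def)
    ultimately show "flag_feature k (induced G ?A, f) = (\<Sum>us\<in>distinct_lists 2 X.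
            real_of_int (vertex_feature (adj G) (f 0) (f 1) (us ! 0) (us ! 1) ! k))"
      by (simp add: flag_feature_def)
  qed
  also have "\<dots> = (\<Sum>us\<in>distinct_lists 2 (verts G - {f 0, f 1}).
            real_of_int (vertex_feature (adj G) (f 0) (f 1) (us ! 0) (us ! 1) ! k))"
    by (rule sum_distinct_lists_by_set[OF fin, symmetric])
  finally show ?thesis .
qed

definition pair_product :: "('a \<Rightarrow> 'a \<Rightarrow> bool) \<Rightarrow> 'a \<Rightarrow> 'a \<Rightarrow> 'a list \<Rightarrow> 'a list \<Rightarrow> real" where
  "pair_product e x y us vs = real_of_int (weighted_inner weights
     (vertex_feature e x y (us ! 0) (us ! 1)) (vertex_feature e x y (vs ! 0) (vs ! 1)))"

text \<open>The square of a sum over ordered pairs is a double sum, and adding the five coordinates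
  turns each term into a weighted inner product. The two pairs vary independently and may
  overlap.\<close>

lemma flag_quadratic_form_certificate:
  fixes G :: "nat graph"
  assumes G: "is_graph G" and f: "f \<in> {..<2} \<rightarrow>\<^sub>E verts G" "inj_on f {..<2}"
  defines "W \<equiv> distinct_lists 2 (verts G - {f 0, f 1})"
  shows "flag_quadratic_form 6 (root_type 2 G f) (certificate_matrix (root_type 2 G f)) (G, f)
       = (\<Sum>us\<in>W. \<Sum>vs\<in>W. pair_product (adj G) (f 0) (f 1) us vs) / 161280"
proof -
  let ?\<tau> = "root_type 2 G f"
  let ?v = "\<lambda>us k. real_of_int (vertex_feature (adj G) (f 0) (f 1) (us ! 0) (us ! 1) ! k)"
  let ?w = "\<lambda>k. real_of_int (weights ! k) / 161280"
  have card: "card (verts ?\<tau>) = 2" by (simp add: root_type_def)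
  have "flag_quadratic_form 6 ?\<tau> (certificate_matrix ?\<tau>) (G, f)
     = (\<Sum>F\<in>unlabelled_flags ?\<tau> 4. \<Sum>H\<in>unlabelled_flags ?\<tau> 4.
          real (flag_count 2 F (G, f)) * (\<Sum>k<5. ?w k * flag_feature k F * flag_feature k H)
            * real (flag_count 2 H (G, f)))"
    unfolding flag_quadratic_form_def flag_index_def certificate_matrix_def card by simp
  also have "\<dots> = (\<Sum>k<5. ?w k * (\<Sum>us\<in>W. ?v us k)\<^sup>2)"
    unfolding quadratic_form_rank_one_sum sum_flag_feature_count[OF G f] W_def ..
  also have "\<dots> = (\<Sum>k<5. \<Sum>us\<in>W. \<Sum>vs\<in>W. ?w k * (?v us k * ?v vs k))"
    unfolding power2_eq_square sum_product unfolding sum_distrib_left ..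
  also have "\<dots> = (\<Sum>us\<in>W. \<Sum>vs\<in>W. \<Sum>k<5. ?w k * (?v us k * ?v vs k))"
    by (simp only: sum.swap[of _ W "{..<5}"])
  also have "\<dots> = (\<Sum>us\<in>W. \<Sum>vs\<in>W. pair_product (adj G) (f 0) (f 1) us vs / 161280)"
    by (simp add: pair_product_def weighted_inner_weights length_vertex_feature sum_divide_distrib mult_ac)
  finally show ?thesis by (simp add: sum_divide_distrib)
qed

lemma sum_injections_2:
  fixes g :: "'a \<Rightarrow> 'a \<Rightarrow> 'b::comm_monoid_add"
  shows "(\<Sum>f\<in>{f \<in> {..<2::nat} \<rightarrow>\<^sub>E V. inj_on f {..<2}}. g (f 0) (f 1))
       = (\<Sum>xs\<in>distinct_lists 2 V. g (xs ! 0) (xs ! 1))"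
proof (rule sum.reindex_bij_witness[where i = "\<lambda>xs. \<lambda>i\<in>{..<2}. xs ! i" and j = "\<lambda>f. [f 0, f 1]"])
  fix f assume "f \<in> {f \<in> {..<2::nat} \<rightarrow>\<^sub>E V. inj_on f {..<2}}"
  then have f: "f \<in> {..<2::nat} \<rightarrow>\<^sub>E V" "inj_on f {..<2}" by auto
  show "(\<lambda>i\<in>{..<2}. [f 0, f 1] ! i) = f"
  proof
    fix i show "(\<lambda>i\<in>{..<2}. [f 0, f 1] ! i) i = f i"
      using f(1) by (cases "i < 2") (auto simp: less_2_cases_iff PiE_def extensional_def)
  qed
  show "[f 0, f 1] \<in> distinct_lists 2 V"
  proof -
    have "f 0 \<in> V" "f 1 \<in> V" using PiE_mem[OF f(1)] by simp_all
    moreover have "f 0 \<noteq> f 1" using inj_on_eq_iff[OF f(2), of 0 1] by simp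
    ultimately show ?thesis by (simp add: distinct_lists_def)
  qed
  show "g ([f 0, f 1] ! 0) ([f 0, f 1] ! 1) = g (f 0) (f 1)" by simp
next
  fix xs assume xs: "xs \<in> distinct_lists 2 V"
  then obtain a b where ab: "xs = [a, b]" "a \<noteq> b" "a \<in> V" "b \<in> V"
    by (auto simp: distinct_lists_def length_Suc_conv numeral_2_eq_2)
  then show "[(\<lambda>i\<in>{..<2}. xs ! i) 0, (\<lambda>i\<in>{..<2}. xs ! i) 1] = xs" by simp
  show "(\<lambda>i\<in>{..<2}. xs ! i) \<in> {f \<in> {..<2::nat} \<rightarrow>\<^sub>E V. inj_on f {..<2}}"
    using ab by (auto simp: less_2_cases_iff inj_on_def)
qed

text \<open>The two quantities differ only by the terms in which the two pairs of unlabelled vertices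
  overlap.\<close>

lemma quadratic_forms_approximation:
  obtains K where "\<And>G :: nat graph. is_graph G \<Longrightarrow>
    \<bar>(\<Sum>f\<in>{f \<in> {..<2} \<rightarrow>\<^sub>E verts G. inj_on f {..<2}}.
        flag_quadratic_form 6 (root_type 2 G f) (certificate_matrix (root_type 2 G f)) (G, f))
      - feature_total G\<bar> \<le> K * real (card (verts G)) ^ 5"
proof -
  obtain C where "C \<ge> 0" and bound:
    "\<And>(e :: nat \<Rightarrow> nat \<Rightarrow> bool) x y z t (e' :: nat \<Rightarrow> nat \<Rightarrow> bool) x' y' z' t'.
       \<bar>real_of_int (weighted_inner weights
         (vertex_feature e x y z t) (vertex_feature e' x' y' z' t'))\<bar> \<le> C"
    using weighted_inner_feature_bounded[where 'a = nat and 'b = nat] by metis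
  have C: "\<bar>pair_product e x y us vs\<bar> \<le> C" for e :: "nat \<Rightarrow> nat \<Rightarrow> bool" and x y us vs
    unfolding pair_product_def by (rule bound)
  have "\<bar>(\<Sum>f\<in>{f \<in> {..<2} \<rightarrow>\<^sub>E verts G. inj_on f {..<2}}.
        flag_quadratic_form 6 (root_type 2 G f) (certificate_matrix (root_type 2 G f)) (G, f))
      - feature_total G\<bar> \<le> 4 * C / 161280 * real (card (verts G)) ^ 5"
    if G: "is_graph G" for G :: "nat graph"
  proof -
    define V where "V = verts G"
    define n where "n = card V"
    have fin: "finite V" using G by (simp add: V_def is_graph_def)
    let ?D = "distinct_lists 2"
    let ?m = "\<lambda>xs us vs. pair_product (adj G) (xs ! 0) (xs ! 1) us vs"
    have card_le: "real (card (?D A)) \<le> real n ^ 2" if "A \<subseteq> V" for A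
    proof -
      have "card A \<le> n" using that fin by (simp add: n_def card_mono)
      then have "card A * (card A - 1) \<le> n * n" by (intro mult_le_mono) auto
      then show ?thesis
        using card_distinct_lists_2[of A] that fin
        by (metis finite_subset of_nat_le_iff of_nat_mult power2_eq_square)
    qed
    have set2: "set xs = {xs ! 0, xs ! 1}" if "xs \<in> ?D V" for xs
      using that by (auto simp: distinct_lists_def length_Suc_conv numeral_2_eq_2)
    have forms: "(\<Sum>f\<in>{f \<in> {..<2} \<rightarrow>\<^sub>E verts G. inj_on f {..<2}}.
        flag_quadratic_form 6 (root_type 2 G f) (certificate_matrix (root_type 2 G f)) (G, f))
      = (\<Sum>xs\<in>?D V. \<Sum>us\<in>?D (V - set xs). \<Sum>vs\<in>?D (V - set xs). ?m xs us vs) / 161280"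
    proof -
      have "(\<Sum>f\<in>{f \<in> {..<2} \<rightarrow>\<^sub>E verts G. inj_on f {..<2}}.
        flag_quadratic_form 6 (root_type 2 G f) (certificate_matrix (root_type 2 G f)) (G, f))
       = (\<Sum>f\<in>{f \<in> {..<2::nat} \<rightarrow>\<^sub>E V. inj_on f {..<2}}.
           (\<Sum>us\<in>?D (V - {f 0, f 1}). \<Sum>vs\<in>?D (V - {f 0, f 1}).
              pair_product (adj G) (f 0) (f 1) us vs) / 161280)"
        unfolding V_def
        by (rule sum.cong[OF refl], rule flag_quadratic_form_certificate[OF G]) simp_all
      also have "\<dots> = (\<Sum>xs\<in>?D V.
           (\<Sum>us\<in>?D (V - {xs ! 0, xs ! 1}). \<Sum>vs\<in>?D (V - {xs ! 0, xs ! 1}). ?m xs us vs) / 161280)"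
        by (rule sum_injections_2)
      also have "\<dots> = (\<Sum>xs\<in>?D V.
           (\<Sum>us\<in>?D (V - set xs). \<Sum>vs\<in>?D (V - set xs). ?m xs us vs) / 161280)"
        by (rule sum.cong[OF refl]) (simp only: set2)
      finally show ?thesis by (simp add: sum_divide_distrib)
    qed
    have total: "feature_total G
      = (\<Sum>xs\<in>?D V. \<Sum>us\<in>?D (V - set xs). \<Sum>vs\<in>?D (V - set xs - set us). ?m xs us vs) / 161280"
    proof -
      have prod: "real_of_int (feature_product (adj G) (xs @ us @ vs)) = ?m xs us vs"
        if "xs \<in> ?D V" "us \<in> ?D (V - set xs)" for xs us vs
        using that
        by (auto simp: feature_product_def pair_product_def nth_append distinct_lists_def)
      have "feature_total G
        = (\<Sum>xs\<in>?D V. \<Sum>us\<in>?D (V - set xs). \<Sum>vs\<in>?D (V - set xs - set us).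
             real_of_int (feature_product (adj G) (xs @ us @ vs))) / 161280"
        using fin
        by (simp add: feature_total_def V_def sum_distinct_lists_append[where m = 2 and n = 4, simplified]
            sum_distinct_lists_append[where m = 2 and n = 2, simplified])
      then show ?thesis using prod by simp
    qed
    have inner: "\<bar>(\<Sum>vs\<in>?D A. ?m xs us vs) - (\<Sum>vs\<in>?D (A - set us). ?m xs us vs)\<bar> \<le> 4 * C * real n"
      if A: "A \<subseteq> V" and us: "us \<in> ?D A" for A xs us
    proof -
      have finA: "finite A" using A fin finite_subset by blast
      have "card (set us) = 2" "set us \<subseteq> A" using us by (auto simp: distinct_lists_def distinct_card)
      then have "card (A - set us) = card A - 2" "2 \<le> card A"
        using finA by (auto simp: card_Diff_subset dest: card_mono[OF finA])
      moreover have "card A \<le> n" using A fin by (simp add: n_def card_mono)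
      moreover obtain d where d: "card A = d + 2" using \<open>2 \<le> card A\<close> by (metis add.commute le_iff_add)
      ultimately have diff: "card (A - set us) = d" "d + 2 \<le> n" by simp_all
      have "d * (d - 1) + d = d * d" by (cases d) simp_all
      then have "real (d * (d - 1)) = real d * real d - real d"
        by (metis add_diff_cancel_right' of_nat_add of_nat_mult)
      \<comment> \<open>With d + 2 available vertices the pairs meeting \<open>us\<close> number (d
        + 2)(d + 1) - d(d - 1) = 4d + 2, which is at most 4n.\<close>
      then have card: "real (card (?D A)) - real (card (?D (A - set us))) \<le> 4 * real n"
        using finA d diff by (simp add: card_distinct_lists_2 algebra_simps)
      have sub: "?D (A - set us) \<subseteq> ?D A" by (auto simp: distinct_lists_def)
      have "(\<Sum>vs\<in>?D A. ?m xs us vs) - (\<Sum>vs\<in>?D (A - set us). ?m xs us vs)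
          = (\<Sum>vs\<in>?D A - ?D (A - set us). ?m xs us vs)"
        using sub finA by (simp add: sum_diff finite_distinct_lists)
      also have "\<bar>\<dots>\<bar> \<le> real (card (?D A - ?D (A - set us))) * C"
        using C by (intro order_trans[OF sum_abs] sum_bounded_above) auto
      also have "real (card (?D A - ?D (A - set us))) = real (card (?D A)) - real (card (?D (A - set us)))"
        using sub finA by (simp add: card_Diff_subset finite_distinct_lists of_nat_diff card_mono)
      also have "\<dots> * C \<le> 4 * real n * C"
        using card \<open>C \<ge> 0\<close> by (rule mult_right_mono)
      finally show ?thesis by (simp add: mult_ac)
    qed
    have mid: "\<bar>(\<Sum>us\<in>?D (V - set xs). (\<Sum>vs\<in>?D (V - set xs). ?m xs us vs)
          - (\<Sum>vs\<in>?D (V - set xs - set us). ?m xs us vs))\<bar> \<le> real n ^ 2 * (4 * C * real n)" for xs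
    proof -
      have "\<bar>(\<Sum>us\<in>?D (V - set xs). (\<Sum>vs\<in>?D (V - set xs). ?m xs us vs)
          - (\<Sum>vs\<in>?D (V - set xs - set us). ?m xs us vs))\<bar>
        \<le> real (card (?D (V - set xs))) * (4 * C * real n)"
        by (intro order_trans[OF sum_abs] sum_bounded_above inner) auto
      also have "\<dots> \<le> real n ^ 2 * (4 * C * real n)"
        using \<open>C \<ge> 0\<close> by (intro mult_right_mono card_le) auto
      finally show ?thesis .
    qed
    have "\<bar>(\<Sum>xs\<in>?D V. (\<Sum>us\<in>?D (V - set xs). (\<Sum>vs\<in>?D (V - set xs). ?m xs us vs)
          - (\<Sum>vs\<in>?D (V - set xs - set us). ?m xs us vs)))\<bar>
        \<le> real (card (?D V)) * (real n ^ 2 * (4 * C * real n))"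
      by (intro order_trans[OF sum_abs] sum_bounded_above mid)
    also have "\<dots> \<le> real n ^ 2 * (real n ^ 2 * (4 * C * real n))"
      using \<open>C \<ge> 0\<close> by (intro mult_right_mono card_le) auto
    also have "\<dots> = 4 * C * real n ^ 5" by (simp add: eval_nat_numeral)
    finally show ?thesis
      unfolding forms total
      by (simp add: sum_subtractf diff_divide_distrib[symmetric] abs_divide divide_right_mono n_def V_def)
  qed
  then show ?thesis using that by blast
qed

section \<open>Assembling the certificate\<close>

lemma feature_total_sum_induced:
  assumes "finite (verts G)"
  shows "feature_total G = (\<Sum>S\<in>ksubsets 6 (verts G). feature_total (induced G S))"
proof -
  \<comment> \<open>A feature product reads only the edges among the entries of its tuple, and six
    distinct entries determine the induced subgraph. Hence the decomposition is exact, without an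
    error term.\<close>
  have "feature_product (adj (induced G S)) p = feature_product (adj G) p" if "p \<in> distinct_lists 6 S" for S p
    using feature_product_cong[OF _ that, where e = "adj (induced G S)" and e' = "adj G" and \<phi> = id]
    by (simp add: induced_def)
  then show ?thesis
    unfolding feature_total_def sum_distinct_lists_by_set[OF assms]
    by (simp add: sum_divide_distrib induced_def)
qed

text \<open>Two vertices admit a single possible edge, so its presence decides both isomorphism and
  equality. Hence every list of representatives contains both two-root types, as it must: types left
  out have to carry the zero matrix.\<close>

lemma graphs_on_2_isomorphic:
  assumes "\<sigma> \<in> graphs_on 2" "\<tau> \<in> graphs_on 2" "isomorphic \<tau> \<sigma>"
  shows "\<tau> = \<sigma>"
proof -
  obtain \<phi> where "is_iso \<phi> \<tau> \<sigma>" using assms(3) by (auto simp: isomorphic_def)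
  moreover have "verts \<tau> = {..<2}" "verts \<sigma> = {..<2}" using assms(1,2) by (auto simp: graphs_on_def)
  ultimately have \<phi>: "bij_betw \<phi> {..<2::nat} {..<2::nat}" and adj: "adj \<tau> 0 1 = adj \<sigma> (\<phi> 0) (\<phi> 1)"
    by (auto simp: is_iso_def)
  have two: "{..<2::nat} = {0, 1}" by auto
  have "{\<phi> 0, \<phi> 1} = {0, 1}" using \<phi> by (simp add: two bij_betw_def)
  then have edge: "{0, 1} \<in> edges \<tau> \<longleftrightarrow> {0, 1} \<in> edges \<sigma>" using adj by simp
  have "edges \<rho> \<subseteq> {{0, 1}}" if "\<rho> \<in> graphs_on 2" for \<rho>
  proof
    fix e assume "e \<in> edges \<rho>"
    moreover have "is_graph \<rho>" "verts \<rho> = {0, 1}" using that by (simp_all add: graphs_on_def two)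
    ultimately have "e \<subseteq> {0, 1}" "card e = 2" unfolding is_graph_def by blast+
    then have "e = {0, 1}" using card_subset_eq[of "{0, 1}" e] by simp
    then show "e \<in> {{0, 1}}" by simp
  qed
  then have "edges \<tau> = edges \<sigma>" using edge assms(1,2) by blast
  then show ?thesis using assms(1,2) by (auto simp: graphs_on_def prod_eq_iff)
qed

text \<open>Because \<open>c\<close> is the slack, its nonnegativity is
  \<open>six_vertex_inequality\<close>, and subtracting the \<open>c\<close>-sum from the left-hand
  side leaves exactly \<open>feature_total G\<close>. Only the comparison with the quadratic forms
  contributes to the error.\<close>

theorem flag_certificate_4_3:
  "flag_certificate 4 3 (1/2) 6 (representatives isomorphic (types 6)) certificate_matrix
     (\<lambda>F. 1/2 - edge_density 4 3 F - feature_total F)"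
proof -
  let ?T = "representatives isomorphic (types 6)"
  let ?c = "\<lambda>F. 1/2 - edge_density 4 3 F - feature_total F"
  have sizes: "type_sizes 6 = {2, 4}"
  proof -
    have "q \<in> type_sizes 6 \<longleftrightarrow> q \<in> {2, 4}" for q
      unfolding type_sizes_def mem_Collect_eq insert_iff empty_iff by presburger
    then show ?thesis by blast
  qed
  have sub: "?T \<subseteq> types 6" by (rule representatives_subset) (rule isomorphic_refl)
  have unique: "\<exists>!\<sigma>. \<sigma> \<in> ?T \<and> isomorphic \<tau> \<sigma>" if "\<tau> \<in> types 6" for \<tau>
    by (rule representatives_unique[OF that])
      (blast intro: isomorphic_refl isomorphic_sym isomorphic_trans)+
  have types_2: "\<tau> \<in> graphs_on 2" if \<tau>: "\<tau> \<in> types 6" and card: "card (verts \<tau>) = 2" for \<tau>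
  proof -
    obtain q where "\<tau> \<in> graphs_on q" using \<tau> unfolding types_def by blast
    moreover have "q = 2" using calculation card by (simp add: graphs_on_def)
    ultimately show ?thesis by simp
  qed
  have zero: "certificate_matrix \<tau> F H = 0" if \<tau>: "\<tau> \<in> types 6 - ?T" for \<tau> F H
  proof -
    have "card (verts \<tau>) \<noteq> 2"
    proof
      assume "card (verts \<tau>) = 2"
      then have \<tau>2: "\<tau> \<in> graphs_on 2" using \<tau> types_2 by blast
      obtain \<sigma> where \<sigma>: "\<sigma> \<in> ?T" "isomorphic \<tau> \<sigma>" using unique \<tau> by blast
      then have "card (verts \<sigma>) = 2"
        using \<open>card (verts \<tau>) = 2\<close> unfolding is_iso_def isomorphic_def
        by (auto dest: bij_betw_same_card)
      then have "\<sigma> \<in> graphs_on 2" using sub \<sigma>(1) types_2 by blast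
      then show False using graphs_on_2_isomorphic \<tau>2 \<sigma> \<tau> by blast
    qed
    then show ?thesis by (simp add: certificate_matrix_def)
  qed
  have graphs: "is_graph F \<and> card (verts F) = 6" if "F \<in> unlabelled_graphs 6" for F
  proof -
    have "unlabelled_graphs 6 \<subseteq> graphs_on 6"
      unfolding unlabelled_graphs_def by (rule representatives_subset) (rule isomorphic_refl)
    then show ?thesis using that by (auto simp: graphs_on_def)
  qed
  have nonneg: "0 \<le> ?c F" if "F \<in> unlabelled_graphs 6" for F
    using six_vertex_inequality[of F] graphs[OF that] by (simp add: feature_total_def)
  obtain K where K: "\<And>G :: nat graph. is_graph G \<Longrightarrow>
    \<bar>(\<Sum>f\<in>{f \<in> {..<2} \<rightarrow>\<^sub>E verts G. inj_on f {..<2}}.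
        flag_quadratic_form 6 (root_type 2 G f) (certificate_matrix (root_type 2 G f)) (G, f))
      - feature_total G\<bar> \<le> K * real (card (verts G)) ^ 5"
    by (rule quadratic_forms_approximation, rule that)
  have identity: "\<bar>(\<Sum>F\<in>unlabelled_graphs 6. (1/2 - edge_density 4 3 F) * real (graph_count F G))
       - ((\<Sum>q\<in>type_sizes 6. \<Sum>f\<in>{f \<in> {..<q} \<rightarrow>\<^sub>E verts G. inj_on f {..<q}}.
             flag_quadratic_form 6 (root_type q G f) (certificate_matrix (root_type q G f)) (G, f))
          + (\<Sum>F\<in>unlabelled_graphs 6. ?c F * real (graph_count F G)))\<bar>
     \<le> K * real n ^ (6 - 1)" if G: "is_graph G" and n: "card (verts G) = n" for G :: "nat graph" and n
  proof -
    have four: "flag_quadratic_form 6 (root_type 4 G f) (certificate_matrix (root_type 4 G f)) (G, f) = 0" for f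
      by (simp add: flag_quadratic_form_def certificate_matrix_def root_type_def)
    have "(\<Sum>F\<in>unlabelled_graphs 6. feature_total F * real (graph_count F G))
        = (\<Sum>S\<in>ksubsets 6 (verts G). feature_total (induced G S))"
      by (rule sum_graph_count[OF G feature_total_iso])
    also have "\<dots> = feature_total G"
      using G by (intro feature_total_sum_induced[symmetric]) (simp add: is_graph_def)
    finally have "(\<Sum>F\<in>unlabelled_graphs 6. feature_total F * real (graph_count F G)) = feature_total G" .
    then have "(\<Sum>F\<in>unlabelled_graphs 6. (1/2 - edge_density 4 3 F) * real (graph_count F G))
        - (\<Sum>F\<in>unlabelled_graphs 6. ?c F * real (graph_count F G)) = feature_total G"
      by (simp add: sum_subtractf[symmetric] algebra_simps)
    then show ?thesis using K[OF G] n by (simp add: sizes four)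
  qed
  show ?thesis
    unfolding flag_certificate_def
    using sub unique certificate_matrix_psd zero nonneg identity
    by (intro conjI ballI allI exI[of _ K] always_eventually impI) auto
qed

section \<open>The upper bound given by a certificate\<close>

lemma card_supersets:
  assumes "finite V" "S \<subseteq> V"
  shows "card {T \<in> ksubsets N V. S \<subseteq> T} = (if card S \<le> N then (card V - card S) choose (N - card S) else 0)"
proof (cases "card S \<le> N")
  case True
  have finS: "finite S" using assms finite_subset by blast
  have "bij_betw (\<lambda>U. U \<union> S) (ksubsets (N - card S) (V - S)) {T \<in> ksubsets N V. S \<subseteq> T}"
  proof (rule bij_betw_byWitness[where f' = "\<lambda>T. T - S"])
    show "\<forall>U\<in>ksubsets (N - card S) (V - S). U \<union> S - S = U"
      by (auto simp: ksubsets_def)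
    show "\<forall>T\<in>{T \<in> ksubsets N V. S \<subseteq> T}. T - S \<union> S = T" by auto
    show "(\<lambda>U. U \<union> S) ` ksubsets (N - card S) (V - S) \<subseteq> {T \<in> ksubsets N V. S \<subseteq> T}"
    proof
      fix T assume "T \<in> (\<lambda>U. U \<union> S) ` ksubsets (N - card S) (V - S)"
      then obtain U where U: "T = U \<union> S" "U \<subseteq> V - S" "card U = N - card S"
        by (auto simp: ksubsets_def)
      moreover have "finite U" using U(2) assms(1) by (meson finite_Diff finite_subset)
      moreover have "U \<inter> S = {}" using U(2) by auto
      ultimately show "T \<in> {T \<in> ksubsets N V. S \<subseteq> T}"
        using True finS assms(2) by (auto simp: ksubsets_def card_Un_disjoint)
    qed
    show "(\<lambda>T. T - S) ` {T \<in> ksubsets N V. S \<subseteq> T} \<subseteq> ksubsets (N - card S) (V - S)"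
      using finS by (auto simp: ksubsets_def card_Diff_subset)
  qed
  then have "card {T \<in> ksubsets N V. S \<subseteq> T} = card (ksubsets (N - card S) (V - S))"
    by (simp add: bij_betw_same_card)
  then show ?thesis using True assms finS by (simp add: card_ksubsets card_Diff_subset)
next
  case False
  have "\<not> S \<subseteq> T" if "T \<in> ksubsets N V" for T
  proof
    assume "S \<subseteq> T"
    moreover have "finite T" "card T = N"
      using that assms(1) finite_subset[of T V] by (simp_all add: ksubsets_def)
    ultimately show False using False card_mono[of T S] by simp
  qed
  then have empty: "{T \<in> ksubsets N V. S \<subseteq> T} = {}" by blast
  show ?thesis unfolding empty using False by simp
qed

text \<open>The density of G is the average of the densities of its N-vertex induced subgraphs:
  every k-set lies in C(n - k, N - k) of the N-sets, and C(n, N) C(N, k) = C(n, k) C(n - k, N -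
  k).\<close>

lemma sum_edge_density_induced:
  assumes G: "is_graph G" and "k \<le> N" "N \<le> card (verts G)"
  shows "(\<Sum>S\<in>ksubsets N (verts G). edge_density k l (induced G S))
       = real (card (verts G) choose N) * edge_density k l G"
proof -
  let ?n = "card (verts G)"
  have fin: "finite (verts G)" using G by (simp add: is_graph_def)
  define A where "A = {S \<in> ksubsets k (verts G). card (edges (induced G S)) = l}"
  have finA: "finite A" using fin by (simp add: A_def finite_ksubsets)
  have "real (N choose k) * edge_density k l (induced G T) = real (card {S \<in> A. S \<subseteq> T})"
    if T: "T \<in> ksubsets N (verts G)" for T
  proof -
    have "edges (induced (induced G T) S) = edges (induced G S)" if "S \<subseteq> T" for S
      using that by (auto simp: induced_def)
    then have "{S. S \<subseteq> verts (induced G T) \<and> card S = k \<and> card (edges (induced (induced G T) S)) = l}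
        = {S \<in> A. S \<subseteq> T}"
      using T by (auto simp: A_def ksubsets_def induced_def)
    moreover have "card (verts (induced G T)) = N" using T by (simp add: ksubsets_def induced_def)
    moreover have "(N choose k) > 0" using assms(2) by (simp add: zero_less_binomial)
    ultimately show ?thesis by (simp add: edge_density_def)
  qed
  then have "real (N choose k) * (\<Sum>T\<in>ksubsets N (verts G). edge_density k l (induced G T))
      = (\<Sum>T\<in>ksubsets N (verts G). real (card {S \<in> A. S \<subseteq> T}))"
    by (simp add: sum_distrib_left)
  also have "\<dots> = (\<Sum>T\<in>ksubsets N (verts G). \<Sum>S\<in>A. of_bool (S \<subseteq> T))"
    using finA by (simp add: Int_def)
  also have "\<dots> = (\<Sum>S\<in>A. \<Sum>T\<in>ksubsets N (verts G). of_bool (S \<subseteq> T))"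
    by (rule sum.swap)
  also have "\<dots> = (\<Sum>S\<in>A. real (card {T \<in> ksubsets N (verts G). S \<subseteq> T}))"
    using fin by (simp add: Int_def finite_ksubsets)
  also have "\<dots> = (\<Sum>S\<in>A. real ((?n - k) choose (N - k)))"
  proof (rule sum.cong[OF refl])
    fix S assume "S \<in> A"
    then have "S \<subseteq> verts G" "card S = k" by (auto simp: A_def ksubsets_def)
    then show "real (card {T \<in> ksubsets N (verts G). S \<subseteq> T}) = real ((?n - k) choose (N - k))"
      using card_supersets[OF fin, of S N] assms(2) by simp
  qed
  also have "\<dots> = real (card A) * real ((?n - k) choose (N - k))" by simp
  also have "real (card A) = real (?n choose k) * edge_density k l G"
  proof -
    have "(?n choose k) > 0" using assms(2,3) by (simp add: zero_less_binomial)
    then show ?thesis by (simp add: edge_density_def A_def ksubsets_def conj_assoc)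
  qed
  also have "real (?n choose k) * edge_density k l G * real ((?n - k) choose (N - k))
      = real (N choose k) * (real (?n choose N) * edge_density k l G)"
    using choose_mult[OF assms(2,3)] by (simp add: mult_ac flip: of_nat_mult)
  finally show ?thesis using assms(2) by simp
qed

lemma flag_quadratic_form_nonneg:
  assumes "psd_on (flag_index N \<tau>) M"
  shows "0 \<le> flag_quadratic_form N \<tau> M H"
  using assms by (simp add: psd_on_def flag_quadratic_form_def)

text \<open>Dropping the nonnegative terms leaves C(n, N) (density - u) \<le> K n^(N - 1) by
  averaging over N-sets; with C(n, N) \<ge> (n / N)^N the excess over u is at most a constant over
  n.\<close>

lemma flag_certificate_bound:
  assumes cert: "flag_certificate k l u N T X c" and "N > 0"
  obtains K where "\<forall>\<^sub>F n in sequentially. \<forall>G :: nat graph. is_graph G \<and> card (verts G) = n \<longrightarrow>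
    edge_density k l G \<le> u + K / real n"
proof -
  obtain K where K: "\<forall>\<^sub>F n in sequentially. \<forall>G :: nat graph. is_graph G \<and> card (verts G) = n \<longrightarrow>
        \<bar>(\<Sum>F\<in>unlabelled_graphs N. (u - edge_density k l F) * real (graph_count F G))
         - ((\<Sum>q\<in>type_sizes N. \<Sum>f\<in>{f \<in> {..<q} \<rightarrow>\<^sub>E verts G. inj_on f {..<q}}.
               flag_quadratic_form N (root_type q G f) (X (root_type q G f)) (G, f))
            + (\<Sum>F\<in>unlabelled_graphs N. c F * real (graph_count F G)))\<bar>
        \<le> K * real n ^ (N - 1)"
    using cert unfolding flag_certificate_def by blast
  have "k \<le> N" and psd: "\<And>\<tau>. \<tau> \<in> types N \<Longrightarrow> psd_on (flag_index N \<tau>) (X \<tau>)"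
    and c: "\<And>F. F \<in> unlabelled_graphs N \<Longrightarrow> 0 \<le> c F"
    using cert unfolding flag_certificate_def by blast+
  have "\<forall>\<^sub>F n in sequentially. \<forall>G :: nat graph. is_graph G \<and> card (verts G) = n \<longrightarrow>
    edge_density k l G \<le> u + (\<bar>K\<bar> * real N ^ N) / real n"
    using K eventually_ge_at_top[of N]
  proof eventually_elim
    case (elim n)
    show ?case
    proof (intro allI impI)
      fix G :: "nat graph" assume G: "is_graph G \<and> card (verts G) = n"
      have "0 \<le> (\<Sum>q\<in>type_sizes N. \<Sum>f\<in>{f \<in> {..<q} \<rightarrow>\<^sub>E verts G. inj_on f {..<q}}.
               flag_quadratic_form N (root_type q G f) (X (root_type q G f)) (G, f))"
      proof (intro sum_nonneg flag_quadratic_form_nonneg psd)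
        fix q f assume "q \<in> type_sizes N"
        then show "root_type q G f \<in> types N"
          using root_type_in_graphs_on G unfolding types_def by blast
      qed
      moreover have "0 \<le> (\<Sum>F\<in>unlabelled_graphs N. c F * real (graph_count F G))"
        using c by (intro sum_nonneg mult_nonneg_nonneg) auto
      ultimately have "- (K * real n ^ (N - 1))
          \<le> (\<Sum>F\<in>unlabelled_graphs N. (u - edge_density k l F) * real (graph_count F G))"
        using elim(1) G unfolding abs_le_iff by fastforce
      also have "\<dots> = (\<Sum>S\<in>ksubsets N (verts G). u - edge_density k l (induced G S))"
        using G by (intro sum_graph_count) (auto simp: edge_density_iso)
      also have "\<dots> = real (n choose N) * (u - edge_density k l G)"
        using G \<open>k \<le> N\<close> elim(2)
        by (simp add: sum_subtractf sum_edge_density_induced card_ksubsets is_graph_def algebra_simps)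
      finally have "real (n choose N) * (edge_density k l G - u) \<le> K * real n ^ (N - 1)"
        by (simp add: algebra_simps)
      also have "\<dots> \<le> \<bar>K\<bar> * real n ^ (N - 1)" by (intro mult_right_mono) auto
      finally have upper: "real (n choose N) * (edge_density k l G - u) \<le> \<bar>K\<bar> * real n ^ (N - 1)" .
      have n: "n > 0" using elim(2) \<open>N > 0\<close> by simp
      have "edge_density k l G - u \<le> \<bar>K\<bar> * real N ^ N / real n"
      \<comment> \<open>The lower bound for the binomial coefficient may only be multiplied by a
        nonnegative excess; \<open>\<bar>K\<bar>\<close> keeps the claimed bound valid when the
        excess is not positive.\<close>
      proof (cases "edge_density k l G \<le> u")
        case True
        moreover have "0 \<le> \<bar>K\<bar> * real N ^ N / real n" by simp
        ultimately show ?thesis by linarith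
      next
        case False
        have "(real n / real N) ^ N * (edge_density k l G - u) \<le> \<bar>K\<bar> * real n ^ (N - 1)"
          using False binomial_ge_n_over_k_pow_k[OF elim(2), where 'a = real]
          by (intro order_trans[OF mult_right_mono upper]) auto
        moreover have "real n ^ N = real n ^ (N - 1) * real n"
          using \<open>N > 0\<close> by (metis Suc_diff_1 power_Suc2)
        ultimately have "real n ^ (N - 1) * (real n * (edge_density k l G - u))
            \<le> real n ^ (N - 1) * (\<bar>K\<bar> * real N ^ N)"
          using \<open>N > 0\<close> by (simp add: power_divide field_simps)
        then have "real n * (edge_density k l G - u) \<le> \<bar>K\<bar> * real N ^ N"
          using n by (simp add: mult_le_cancel_left_pos)
        then show ?thesis using n by (simp add: field_simps)
      qed
      then show "edge_density k l G \<le> u + \<bar>K\<bar> * real N ^ N / real n" by simp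
    qed
  qed
  then show ?thesis using that by blast
qed

text \<open>Infinitely many graphs have their n vertices among the natural numbers, but their
  densities share the denominator C(n, k) and have bounded numerators. This finiteness is what makes
  \<open>Max\<close> meaningful.\<close>

lemma finite_edge_densities:
  "finite {edge_density k l G | G :: nat graph. is_graph G \<and> card (verts G) = n}"
proof (rule finite_subset)
  show "{edge_density k l G | G :: nat graph. is_graph G \<and> card (verts G) = n}
      \<subseteq> (\<lambda>i. real i / real (n choose k)) ` {..n choose k}"
  proof
    fix d assume "d \<in> {edge_density k l G | G :: nat graph. is_graph G \<and> card (verts G) = n}"
    then obtain G :: "nat graph" where G: "d = edge_density k l G" "finite (verts G)" "card (verts G) = n"
      by (auto simp: is_graph_def)
    have "card {S. S \<subseteq> verts G \<and> card S = k \<and> card (edges (induced G S)) = l}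
        \<le> card (ksubsets k (verts G))"
      using G(2) by (intro card_mono finite_ksubsets) (auto simp: ksubsets_def)
    then show "d \<in> (\<lambda>i. real i / real (n choose k)) ` {..n choose k}"
      using G by (auto simp: edge_density_def card_ksubsets)
  qed
qed simp

lemma edge_density_le_max:
  fixes G :: "nat graph"
  assumes "is_graph G" "card (verts G) = n"
  shows "edge_density k l G \<le> max_edge_density k l n"
  unfolding max_edge_density_def by (rule Max_ge[OF finite_edge_densities]) (use assms in blast)

lemma max_edge_density_le:
  assumes "\<And>G :: nat graph. is_graph G \<Longrightarrow> card (verts G) = n \<Longrightarrow> edge_density k l G \<le> b"
  shows "max_edge_density k l n \<le> b"
proof -
  have "is_graph ({..<n}, {}) \<and> card (verts ({..<n}, {} :: nat set set)) = n"
    by (simp add: is_graph_def)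
  then have "{edge_density k l G | G :: nat graph. is_graph G \<and> card (verts G) = n} \<noteq> {}" by blast
  then show ?thesis
    unfolding max_edge_density_def
    by (rule Max.boundedI[OF finite_edge_densities]) (use assms in blast)
qed

section \<open>Blowups of the two patterns\<close>

lemma card_split_subsets:
  assumes "finite V" "finite W" "V \<inter> W = {}"
  shows "card {S. S \<subseteq> V \<union> W \<and> card (S \<inter> V) = i \<and> card (S \<inter> W) = j}
       = (card V choose i) * (card W choose j)"
proof -
  have "bij_betw (\<lambda>(A, B). A \<union> B) (ksubsets i V \<times> ksubsets j W)
      {S. S \<subseteq> V \<union> W \<and> card (S \<inter> V) = i \<and> card (S \<inter> W) = j}"
  proof (rule bij_betw_byWitness[where f' = "\<lambda>S. (S \<inter> V, S \<inter> W)"])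
    have split: "(A \<union> B) \<inter> V = A" "(A \<union> B) \<inter> W = B" if "A \<subseteq> V" "B \<subseteq> W" for A B
      using that assms(3) by auto
    show "\<forall>P\<in>ksubsets i V \<times> ksubsets j W.
        ((case P of (A, B) \<Rightarrow> A \<union> B) \<inter> V, (case P of (A, B) \<Rightarrow> A \<union> B) \<inter> W) = P"
      using split by (auto simp: ksubsets_def)
    show "\<forall>S\<in>{S. S \<subseteq> V \<union> W \<and> card (S \<inter> V) = i \<and> card (S \<inter> W) = j}.
        (case (S \<inter> V, S \<inter> W) of (A, B) \<Rightarrow> A \<union> B) = S"
      by auto
    show "(\<lambda>(A, B). A \<union> B) ` (ksubsets i V \<times> ksubsets j W)
        \<subseteq> {S. S \<subseteq> V \<union> W \<and> card (S \<inter> V) = i \<and> card (S \<inter> W) = j}"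
      using split by (fastforce simp: ksubsets_def)
    show "(\<lambda>S. (S \<inter> V, S \<inter> W)) ` {S. S \<subseteq> V \<union> W \<and> card (S \<inter> V) = i \<and> card (S \<inter> W) = j}
        \<subseteq> ksubsets i V \<times> ksubsets j W"
      by (auto simp: ksubsets_def)
  qed
  then have "card {S. S \<subseteq> V \<union> W \<and> card (S \<inter> V) = i \<and> card (S \<inter> W) = j}
      = card (ksubsets i V \<times> ksubsets j W)"
    by (simp add: bij_betw_same_card)
  then show ?thesis using assms by (simp add: card_cartesian_product card_ksubsets)
qed

lemma edges_blowup_two_cliques:
  "edges (blowup (2, {{0, 0}, {1, 1}}) V) = {e. card e = 2 \<and> (e \<subseteq> V 0 \<or> e \<subseteq> V 1)}"
proof (intro equalityI subsetI)
  fix e assume "e \<in> edges (blowup (2, {{0, 0}, {1, 1}}) V)"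
  then obtain x y i j where e: "e = {x, y}" "x \<in> V i" "y \<in> V j" "x \<noteq> y" "{i, j} \<in> {{0, 0}, {1, 1}}"
    by (auto simp: blowup_def)
  then have "i = j" "i = 0 \<or> i = 1" by (auto simp: doubleton_eq_iff)
  then show "e \<in> {e. card e = 2 \<and> (e \<subseteq> V 0 \<or> e \<subseteq> V 1)}" using e by auto
next
  fix e assume "e \<in> {e. card e = 2 \<and> (e \<subseteq> V 0 \<or> e \<subseteq> V 1)}"
  then obtain x y i where e: "e = {x, y}" "x \<noteq> y" "x \<in> V i" "y \<in> V i" "i = 0 \<or> i = (1::nat)"
    by (auto simp: card_2_iff)
  show "e \<in> edges (blowup (2, {{0, 0}, {1, 1}}) V)"
    unfolding blowup_def snd_conv fst_conv mem_Collect_eq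
    by (rule exI[of _ x], rule exI[of _ y], rule exI[of _ i], rule exI[of _ i]) (use e in auto)
qed

lemma edges_blowup_bipartite:
  assumes "V 0 \<inter> V 1 = {}"
  shows "edges (blowup (2, {{0, 1}}) V) = {e. card e = 2 \<and> e \<subseteq> V 0 \<union> V 1 \<and> \<not> (e \<subseteq> V 0 \<or> e \<subseteq> V 1)}"
proof (intro equalityI subsetI)
  fix e assume "e \<in> edges (blowup (2, {{0, 1}}) V)"
  then obtain x y i j where e: "e = {x, y}" "x \<in> V i" "y \<in> V j" "x \<noteq> y" "{i, j} = {0, 1}"
    by (auto simp: blowup_def)
  then have "i = 0 \<and> j = 1 \<or> i = 1 \<and> j = 0" by (auto simp: doubleton_eq_iff)
  then show "e \<in> {e. card e = 2 \<and> e \<subseteq> V 0 \<union> V 1 \<and> \<not> (e \<subseteq> V 0 \<or> e \<subseteq> V 1)}"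
    using e assms by auto
next
  fix e assume "e \<in> {e. card e = 2 \<and> e \<subseteq> V 0 \<union> V 1 \<and> \<not> (e \<subseteq> V 0 \<or> e \<subseteq> V 1)}"
  then obtain x y where e: "e = {x, y}" "x \<noteq> y" "x \<in> V 0" "y \<in> V 1"
    by (auto simp: card_2_iff)
  show "e \<in> edges (blowup (2, {{0, 1}}) V)"
    unfolding blowup_def snd_conv fst_conv mem_Collect_eq
    by (rule exI[of _ x], rule exI[of _ y], rule exI[of _ 0], rule exI[of _ 1]) (use e in auto)
qed

lemma verts_blowup_two: "verts (blowup (2, E) V) = V 0 \<union> V 1"
proof -
  have "{..<2::nat} = {0, 1}" by auto
  then show ?thesis by (simp add: blowup_def lessThan_def[symmetric])
qed

text \<open>A split p + q = 4 leaves C(p, 2) + C(q, 2) pairs inside the parts, namely 6, 3, 2, 3, 6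
  for p = 0, ..., 4. The bipartite blowup has the complementary 6 - C(p, 2) - C(q, 2) edges, and 3
  is its own complement in 6, so both patterns count the splits 3 + 1 and 1 + 3.\<close>

lemma card_edges_induced_blowup:
  assumes B: "B \<in> {(2, {{0, 0}, {1, 1}}), (2, {{0, 1}})}"
    and fin: "finite (V 0)" "finite (V 1)" and disj: "V 0 \<inter> V 1 = {}"
    and S: "S \<subseteq> V 0 \<union> V 1" "card S = 4"
  shows "card (edges (induced (blowup B V) S)) = 3
     \<longleftrightarrow> card (S \<inter> V 0) = 3 \<and> card (S \<inter> V 1) = 1 \<or> card (S \<inter> V 0) = 1 \<and> card (S \<inter> V 1) = 3"
proof -
  let ?P = "S \<inter> V 0" and ?Q = "S \<inter> V 1"
  have finS: "finite S" using S(2) card.infinite by force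
  have "S = ?P \<union> ?Q" "?P \<inter> ?Q = {}" using S(1) disj by auto
  then have pq: "card ?P + card ?Q = 4" using S(2) finS by (metis card_Un_disjoint finite_Int)
  have inner: "{e \<in> ksubsets 2 S. e \<subseteq> V 0 \<or> e \<subseteq> V 1} = ksubsets 2 ?P \<union> ksubsets 2 ?Q"
    by (auto simp: ksubsets_def)
  have "ksubsets 2 ?P \<inter> ksubsets 2 ?Q = {}"
  proof -
    have "e = {} \<and> card e = 2" if "e \<in> ksubsets 2 ?P" "e \<in> ksubsets 2 ?Q" for e
      using that disj by (auto simp: ksubsets_def)
    then show ?thesis by fastforce
  qed
  then have card_inner: "card {e \<in> ksubsets 2 S. e \<subseteq> V 0 \<or> e \<subseteq> V 1}
      = (card ?P choose 2) + (card ?Q choose 2)"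
    unfolding inner using finS by (simp add: card_Un_disjoint finite_ksubsets card_ksubsets)
  have "card ?P \<in> {0, 1, 2, 3, 4}" using pq by auto
  then have cases: "(card ?P, card ?Q) \<in> {(0, 4), (1, 3), (2, 2), (3, 1), (4, 0)}" using pq by auto
  have "(card ?P choose 2) + (card ?Q choose 2) = 3
     \<longleftrightarrow> card ?P = 3 \<and> card ?Q = 1 \<or> card ?P = 1 \<and> card ?Q = 3"
    using cases by (auto simp: eval_nat_numeral)
  moreover have "card (edges (induced (blowup B V) S)) = 3
     \<longleftrightarrow> (card ?P choose 2) + (card ?Q choose 2) = 3"
  proof (cases "B = (2, {{0, 0}, {1, 1}})")
    case True
    have "edges (induced (blowup B V) S) = {e \<in> ksubsets 2 S. e \<subseteq> V 0 \<or> e \<subseteq> V 1}"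
      unfolding True induced_def snd_conv edges_blowup_two_cliques by (auto simp: ksubsets_def)
    then show ?thesis using card_inner by simp
  next
    case False
    then have B: "B = (2, {{0, 1}})" using B by blast
    have "edges (induced (blowup B V) S) = ksubsets 2 S - {e \<in> ksubsets 2 S. e \<subseteq> V 0 \<or> e \<subseteq> V 1}"
      unfolding B induced_def snd_conv edges_blowup_bipartite[OF disj] using S(1)
      by (auto simp: ksubsets_def)
    then have "card (edges (induced (blowup B V) S)) = 6 - ((card ?P choose 2) + (card ?Q choose 2))"
      using finS card_inner S(2)
      by (simp add: card_Diff_subset finite_ksubsets card_ksubsets choose_two)
    then show ?thesis by linarith
  qed
  ultimately show ?thesis by simp
qed

lemma edge_density_blowup:
  assumes B: "B \<in> {(2, {{0, 0}, {1, 1}}), (2, {{0, 1}})}"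
    and fin: "finite (V 0)" "finite (V 1)" and disj: "V 0 \<inter> V 1 = {}"
  defines "a \<equiv> card (V 0)" and "b \<equiv> card (V 1)"
  shows "edge_density 4 3 (blowup B V)
       = (real (a choose 3) * real b + real a * real (b choose 3)) / real ((a + b) choose 4)"
proof -
  let ?A = "\<lambda>i j. {S. S \<subseteq> V 0 \<union> V 1 \<and> card (S \<inter> V 0) = i \<and> card (S \<inter> V 1) = j}"
  obtain E where "B = (2, E)" using B by blast
  then have verts: "verts (blowup B V) = V 0 \<union> V 1" by (simp only: verts_blowup_two)
  have finA: "finite (?A i j)" for i j using fin by simp
  have card4: "card S = card (S \<inter> V 0) + card (S \<inter> V 1)" if "S \<subseteq> V 0 \<union> V 1" for S
  proof -
    have "S = (S \<inter> V 0) \<union> (S \<inter> V 1)" using that by auto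
    moreover have "(S \<inter> V 0) \<inter> (S \<inter> V 1) = {}" using disj by auto
    ultimately show ?thesis using fin by (metis card_Un_disjoint finite_Int)
  qed
  have "{S. S \<subseteq> verts (blowup B V) \<and> card S = 4 \<and> card (edges (induced (blowup B V) S)) = 3}
      = ?A 3 1 \<union> ?A 1 3"
    unfolding verts
    using card_edges_induced_blowup[OF B fin disj] card4 by (intro equalityI subsetI) auto
  moreover have "?A 3 1 \<inter> ?A 1 3 = {}" by auto
  ultimately have "card {S. S \<subseteq> verts (blowup B V) \<and> card S = 4 \<and> card (edges (induced (blowup B V) S)) = 3}
      = (a choose 3) * b + a * (b choose 3)"
    using finA card_split_subsets[OF fin disj] by (simp add: card_Un_disjoint a_def b_def)
  moreover have "card (verts (blowup B V)) = a + b"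
    unfolding verts using fin disj by (simp add: card_Un_disjoint a_def b_def)
  ultimately show ?thesis by (simp add: edge_density_def)
qed

text \<open>C(c, k) / n^k is the product of the k factors c/n - i/n divided by k!, and each i/n
  tends to 0. The falling product over the reals also covers c < k.\<close>

lemma choose_div_power_tendsto:
  assumes "(\<lambda>n. real (c n) / real n) \<longlonglongrightarrow> x"
  shows "(\<lambda>n. real (c n choose k) / real n ^ k) \<longlonglongrightarrow> x ^ k / fact k"
proof -
  have "(\<lambda>n. (\<Prod>i<k. real (c n) / real n - real i * (1 / real n)) / fact k)
      \<longlonglongrightarrow> (\<Prod>i<k. x - real i * 0) / fact k"
    by (intro tendsto_intros assms lim_const_over_n) auto
  moreover have "\<forall>\<^sub>F n in sequentially.
      (\<Prod>i<k. real (c n) / real n - real i * (1 / real n)) / fact k = real (c n choose k) / real n ^ k"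
    using eventually_gt_at_top[of 0]
  proof eventually_elim
    case (elim n)
    have "(\<Prod>i<k. real (c n) / real n - real i * (1 / real n)) = (\<Prod>i<k. (real (c n) - real i) / real n)"
      by (simp add: diff_divide_distrib)
    also have "\<dots> = (\<Prod>i<k. real (c n) - real i) / real n ^ k"
      by (simp add: prod_dividef)
    finally show ?case
      by (simp add: binomial_gbinomial gbinomial_prod_rev atLeast0LessThan)
  qed
  ultimately show ?thesis by (simp add: tendsto_cong)
qed

lemma has_blowup_density_4_3:
  assumes B: "B \<in> {(2, {{0, 0}, {1, 1}}), (2, {{0, 1}})}" and a: "a \<in> prob_simplex 2"
  shows "has_blowup_density 4 3 B a (1/2 - 8 * (a ! 0 - 1/2) ^ 4)"
  unfolding has_blowup_density_def
proof (intro allI impI)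
  fix V :: "nat \<Rightarrow> nat \<Rightarrow> nat set"
  assume V: "blowup_parts (fst B) a V"
  have "fst B = 2" using B by auto
  then have fin: "finite (V n 0)" "finite (V n 1)" and disj: "V n 0 \<inter> V n 1 = {}"
    and lim0: "(\<lambda>n. real (card (V n 0)) / real n) \<longlonglongrightarrow> a ! 0"
    and lim1: "(\<lambda>n. real (card (V n 1)) / real n) \<longlonglongrightarrow> a ! 1" for n
    using V by (auto simp: blowup_parts_def)
  have a1: "a ! 0 + a ! 1 = 1"
    using a by (simp add: prob_simplex_def numeral_2_eq_2)
  let ?x = "a ! 0" and ?y = "a ! 1"
  let ?c = "\<lambda>n. card (V n 0)" and ?d = "\<lambda>n. card (V n 1)"
  have sum: "(\<lambda>n. real (?c n + ?d n) / real n) \<longlonglongrightarrow> 1"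
    using tendsto_add[OF lim0 lim1] a1 by (simp add: add_divide_distrib)
  \<comment> \<open>Numerator and denominator are divided by n^4, since at stage n the blowup has
    only (1 + o(1)) n vertices.\<close>
  have "(\<lambda>n. (real (?c n choose 3) / real n ^ 3 * (real (?d n) / real n)
        + real (?c n) / real n * (real (?d n choose 3) / real n ^ 3))
      / (real ((?c n + ?d n) choose 4) / real n ^ 4))
    \<longlonglongrightarrow> (?x ^ 3 / fact 3 * ?y + ?x * (?y ^ 3 / fact 3)) / (1 ^ 4 / fact 4)"
    by (intro tendsto_intros choose_div_power_tendsto lim0 lim1 sum) simp
  moreover have "\<forall>\<^sub>F n in sequentially.
      (real (?c n choose 3) / real n ^ 3 * (real (?d n) / real n)
        + real (?c n) / real n * (real (?d n choose 3) / real n ^ 3))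
      / (real ((?c n + ?d n) choose 4) / real n ^ 4) = edge_density 4 3 (blowup B (V n))"
    using eventually_gt_at_top[of 0]
  proof eventually_elim
    case (elim n)
    have scale: "(p / m * (q / k) + r / k * (s / m)) / (t / (m * k)) = (p * q + r * s) / t"
      if "m \<noteq> 0" "k \<noteq> 0" for p q r s t m k :: real
    proof -
      have "p / m * (q / k) + r / k * (s / m) = (p * q + r * s) / (m * k)"
        by (simp add: add_divide_distrib mult.commute)
      then show ?thesis using that by simp
    qed
    have "real n ^ 4 = real n ^ 3 * real n" by (simp add: eval_nat_numeral)
    then show ?case
      using elim unfolding edge_density_blowup[OF B fin disj] by (simp only:) (subst scale, simp_all)
  qed
  ultimately have "(\<lambda>n. edge_density 4 3 (blowup B (V n)))
      \<longlonglongrightarrow> (?x ^ 3 / fact 3 * ?y + ?x * (?y ^ 3 / fact 3)) / (1 ^ 4 / fact 4)"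
    by (simp add: tendsto_cong)
  moreover have "(?x ^ 3 / fact 3 * ?y + ?x * (?y ^ 3 / fact 3)) / (1 ^ 4 / fact 4)
      = 1/2 - 8 * (?x - 1/2) ^ 4"
  proof -
    have y: "?y = 1 - ?x" using a1 by simp
    show ?thesis unfolding y by (simp add: eval_nat_numeral field_simps)
  qed
  ultimately show "(\<lambda>n. edge_density 4 3 (blowup B (V n))) \<longlonglongrightarrow> 1/2 - 8 * (?x - 1/2) ^ 4"
    by simp
qed

text \<open>Explicit parts of the prescribed proportions show that \<open>has_blowup_density\<close>
  is not vacuous, whence the uniqueness of its value. For x in [0, 1] they partition the first n
  natural numbers exactly, so they also supply an n-vertex graph for every n.\<close>

definition interval_parts :: "real \<Rightarrow> nat \<Rightarrow> nat \<Rightarrow> nat set" where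
  "interval_parts x n i = (if i = 0 then {..<nat \<lfloor>x * real n\<rfloor>} else {nat \<lfloor>x * real n\<rfloor>..<n})"

lemma blowup_parts_interval_parts:
  assumes a: "a \<in> prob_simplex 2"
  shows "blowup_parts 2 a (interval_parts (a ! 0))"
proof -
  let ?x = "a ! 0"
  let ?k = "\<lambda>n. nat \<lfloor>?x * real n\<rfloor>"
  have x: "0 \<le> ?x" "?x \<le> 1" "a ! 1 = 1 - ?x"
    using a by (auto simp: prob_simplex_def numeral_2_eq_2 less_Suc_eq)
  have k: "real (?k n) \<le> ?x * real n" "?x * real n - 1 < real (?k n)" for n
    using x(1) by (simp_all add: of_nat_nat)
  have kn: "?k n \<le> n" for n
  proof -
    have "real (?k n) \<le> real n"
      using k(1)[of n] mult_right_mono[OF x(2), of "real n"] by simp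
    then show ?thesis by simp
  qed
  have lim: "(\<lambda>n. real (?k n) / real n) \<longlonglongrightarrow> ?x"
  proof (rule tendsto_sandwich)
    show "\<forall>\<^sub>F n in sequentially. ?x - 1 / real n \<le> real (?k n) / real n"
      using eventually_gt_at_top[of 0]
    proof eventually_elim
      case (elim n)
      then have "?x - 1 / real n = (?x * real n - 1) / real n" by (simp add: diff_divide_distrib)
      then show ?case using k(2)[of n] by (simp add: divide_right_mono)
    qed
    show "\<forall>\<^sub>F n in sequentially. real (?k n) / real n \<le> ?x"
      using eventually_gt_at_top[of 0]
    proof eventually_elim
      case (elim n)
      then show ?case using k(1)[of n] by (simp add: field_simps)
    qed
    show "(\<lambda>n. ?x - 1 / real n) \<longlonglongrightarrow> ?x"
      using tendsto_diff[OF tendsto_const lim_const_over_n[of 1], of ?x] by simp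
  qed simp
  have "(\<lambda>n. real (n - ?k n) / real n) \<longlonglongrightarrow> 1 - ?x"
  proof (rule Lim_transform_eventually)
    show "(\<lambda>n. 1 - real (?k n) / real n) \<longlonglongrightarrow> 1 - ?x"
      by (intro tendsto_intros lim)
    show "\<forall>\<^sub>F n in sequentially. 1 - real (?k n) / real n = real (n - ?k n) / real n"
      using eventually_gt_at_top[of 0]
    proof eventually_elim
      case (elim n)
      then show ?case using kn[of n] by (simp add: of_nat_diff diff_divide_distrib)
    qed
  qed
  then show ?thesis
    using lim x(3) by (auto simp: blowup_parts_def interval_parts_def less_2_cases_iff)
qed

lemma blowup_density_unique:
  assumes "blowup_parts (fst B) x V" "has_blowup_density \<kappa> l B x L" "has_blowup_density \<kappa> l B x L'"
  shows "L = L'"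
  using assms LIMSEQ_unique unfolding has_blowup_density_def by blast

lemma blowup_density_4_3:
  assumes B: "B \<in> {(2, {{0, 0}, {1, 1}}), (2, {{0, 1}})}" and a: "a \<in> prob_simplex 2"
  shows "\<exists>!L. has_blowup_density 4 3 B a L"
    and "blowup_density 4 3 B a = 1/2 - 8 * (a ! 0 - 1/2) ^ 4"
proof -
  have "fst B = 2" using B by auto
  then have parts: "blowup_parts (fst B) a (interval_parts (a ! 0))"
    using blowup_parts_interval_parts[OF a] by simp
  note L = has_blowup_density_4_3[OF B a]
  show "\<exists>!L. has_blowup_density 4 3 B a L"
    using L blowup_density_unique[OF parts] by blast
  show "blowup_density 4 3 B a = 1/2 - 8 * (a ! 0 - 1/2) ^ 4"
    unfolding blowup_density_def using L blowup_density_unique[OF parts] by blast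
qed

section \<open>The unique maximizer and the limit of the maximum density\<close>

lemma half_in_prob_simplex: "[1/2, 1/2] \<in> prob_simplex 2"
  by (auto simp: prob_simplex_def numeral_2_eq_2 less_Suc_eq)

lemma prob_simplex_2_eq_half:
  assumes "a \<in> prob_simplex 2" "a ! 0 = 1/2"
  shows "a = [1/2, 1/2]"
proof -
  have "length a = 2" "a ! 1 = 1/2"
    using assms by (auto simp: prob_simplex_def numeral_2_eq_2)
  then show ?thesis using assms(2) by (intro nth_equalityI) (auto simp: less_2_cases_iff)
qed

lemma maximizer_4_3:
  assumes B: "B \<in> {(2, {{0, 0}, {1, 1}}), (2, {{0, 1}})}"
  shows "maximizer 4 3 B a \<longleftrightarrow> a = [1/2, 1/2]"
proof
  assume max: "maximizer 4 3 B a"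
  have "fst B = 2" using B by auto
  then have a: "a \<in> prob_simplex 2"
    and "blowup_density 4 3 B [1/2, 1/2] \<le> blowup_density 4 3 B a"
    using max half_in_prob_simplex by (auto simp: maximizer_def)
  then have "(a ! 0 - 1/2) ^ 4 \<le> 0"
    using blowup_density_4_3(2)[OF B] half_in_prob_simplex by simp
  moreover have "0 \<le> (a ! 0 - 1/2) ^ 4" by simp
  ultimately have "(a ! 0 - 1/2) ^ 4 = 0" by linarith
  then have "a ! 0 = 1/2" by simp
  then show "a = [1/2, 1/2]" using prob_simplex_2_eq_half a by blast
next
  assume "a = [1/2, 1/2]"
  moreover have "fst B = 2" using B by auto
  ultimately show "maximizer 4 3 B a"
    using half_in_prob_simplex blowup_density_4_3(2)[OF B] by (simp add: maximizer_def)
qed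

text \<open>The maximum is squeezed between the density of a nearly balanced complete bipartite
  graph on exactly n vertices and the bound 1/2 + K/n, which yields the existence of the limit along
  with its value.\<close>

lemma max_edge_density_4_3_tendsto: "max_edge_density 4 3 \<longlonglongrightarrow> 1/2"
proof -
  obtain K where K: "\<forall>\<^sub>F n in sequentially. \<forall>G :: nat graph. is_graph G \<and> card (verts G) = n \<longrightarrow>
      edge_density 4 3 G \<le> 1/2 + K / real n"
    using flag_certificate_bound[OF flag_certificate_4_3] by auto
  let ?B = "(2, {{0, 1}}) :: pattern"
  let ?V = "interval_parts (1/2)"
  have B: "?B \<in> {(2, {{0, 0}, {1, 1}}), (2, {{0, 1}})}" by simp
  have parts: "blowup_parts 2 [1/2, 1/2] ?V"
    using blowup_parts_interval_parts[OF half_in_prob_simplex] by simp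
  have graph: "is_graph (blowup ?B (?V n)) \<and> card (verts (blowup ?B (?V n))) = n" for n
  proof -
    have "nat \<lfloor>1 / 2 * real n\<rfloor> \<le> n" by linarith
    then have V: "?V n 0 \<union> ?V n 1 = {..<n}" "?V n 0 \<inter> ?V n 1 = {}"
      by (auto simp: interval_parts_def)
    then have verts: "verts (blowup ?B (?V n)) = {..<n}" by (simp add: verts_blowup_two)
    show ?thesis
      unfolding is_graph_def verts edges_blowup_bipartite[of "?V n", OF V(2)] V(1) by auto
  qed
  show ?thesis
  proof (rule tendsto_sandwich)
    show "\<forall>\<^sub>F n in sequentially. edge_density 4 3 (blowup ?B (?V n)) \<le> max_edge_density 4 3 n"
      using edge_density_le_max graph by (intro always_eventually) blast
    show "\<forall>\<^sub>F n in sequentially. max_edge_density 4 3 n \<le> 1/2 + K / real n"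
      using K by eventually_elim (auto intro: max_edge_density_le)
    show "(\<lambda>n. edge_density 4 3 (blowup ?B (?V n))) \<longlonglongrightarrow> 1/2"
      using has_blowup_density_4_3[OF B half_in_prob_simplex] parts
      by (simp add: has_blowup_density_def)
    show "(\<lambda>n. 1/2 + K / real n) \<longlonglongrightarrow> 1/2"
      using tendsto_add[OF tendsto_const lim_const_over_n[of K], of "1/2"] by simp
  qed
qed

theorem theorem3p2:
  "(convergent (max_edge_density 4 3) \<and> edge_inducibility 4 3 = 1/2) \<and>
   (\<forall>B \<in> {(2, {{0,0},{1,1}}), (2, {{0,1}})}.
      (\<forall>a\<in>prob_simplex 2. \<exists>!L. has_blowup_density 4 3 B a L) \<and>
      (\<exists>a\<in>prob_simplex 2. blowup_density 4 3 B a = 1/2) \<and>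
      (\<forall>a\<in>prob_simplex 2. blowup_density 4 3 B a \<le> 1/2) \<and>
      (\<forall>a. maximizer 4 3 B a \<longleftrightarrow> a = [1/2, 1/2])) \<and>
   (\<exists>T X c. flag_certificate 4 3 (1/2) 6 T X c)"
proof (intro conjI ballI)
  show "convergent (max_edge_density 4 3)"
    using max_edge_density_4_3_tendsto by (rule convergentI)
  show "edge_inducibility 4 3 = 1/2"
    unfolding edge_inducibility_def using max_edge_density_4_3_tendsto by (rule limI)
  show "\<exists>T X c. flag_certificate 4 3 (1/2) 6 T X c"
    using flag_certificate_4_3 by blast
next
  fix B :: pattern and a :: "real list"
  assume B: "B \<in> {(2, {{0,0},{1,1}}), (2, {{0,1}})}" and a: "a \<in> prob_simplex 2"
  show "\<exists>!L. has_blowup_density 4 3 B a L" by (rule blowup_density_4_3(1)[OF B a])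
  show "blowup_density 4 3 B a \<le> 1/2" by (simp add: blowup_density_4_3(2)[OF B a])
next
  fix B :: pattern assume B: "B \<in> {(2, {{0,0},{1,1}}), (2, {{0,1}})}"
  show "\<exists>a\<in>prob_simplex 2. blowup_density 4 3 B a = 1/2"
    by (rule bexI[OF _ half_in_prob_simplex])
      (simp add: blowup_density_4_3(2)[OF B half_in_prob_simplex])
  show "\<forall>a. maximizer 4 3 B a \<longleftrightarrow> a = [1/2, 1/2]" using maximizer_4_3[OF B] by blast
qed

end
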